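(* Let $n>m>1$, and let $\mathcal{K}=\mathcal{K}(\mathbb{X}_{m,n})=\mathbb{C}(u)$, $u=(u_{i,j})_{1\le i\le m-1,\ m+2\le j\le n}$, with the points $p_1,\dots,p_n$, the homogeneous coordinates $x=(x_1,\dots,x_m)$, the group $W_{m,n}$ acting on $\mathcal{K}(\mathbb{X}_{m,n+1})=\mathbb{C}(u,z)$, the lattice $L_{m,n}$, the orbit $M_{m,n}$ and the spaces $L(\Lambda)$ as described in the context. (1) For every $\Lambda\in M_{m,n}$ one has $\dim_{\mathcal{K}}L(\Lambda)=1$. (2) Let $w\in W_{m,n}$ and choose nonzero polynomials $F_i(x)\in L(w.e_i)$ and $G_i(x)\in L(ws_0.e_i)$ for $i=1,\dots,m$. Then $$(w(z_1):\dots:w(z_{m-1}):1)=\Big(c_1\frac{G_1(x)}{F_1(x)}:\dots:c_m\frac{G_m(x)}{F_m(x)}\Big)$$ for some nonzero constants $c_1,\dots,c_m\in\mathcal{K}$.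
   Context: An $n$-tuple $(p_1,\dots,p_n)$ of points of $\mathbb{P}^{m-1}(\mathbb{C})$ is in general position if the points are distinct and every hyperplane contains fewer than $m$ of them. $\mathbb{X}_{m,n}$ is the space of such $n$-tuples modulo the diagonal $PGL_m(\mathbb{C})$-action; the class is written $[p_1,\dots,p_n]$. Every class has a unique representative with $p_1=(1:0:\dots:0),\dots,p_m=(0:\dots:0:1)$, $p_{m+1}=(1:\dots:1)$, $p_j=(u_{1,j}:\dots:u_{m-1,j}:1)$ for $m+2\le j\le n$; this identifies $\mathbb{X}_{m,n}$ with a Zariski open subset of $\mathbb{C}^{(m-1)(n-m-1)}$ with coordinates $u_{i,j}$, and $\mathcal{K}(\mathbb{X}_{m,n})=\mathbb{C}(u)$. Similarly $\mathbb{X}_{m,n+1}$ has coordinates $(u,z)$ with $z=(z_1,\dots,z_{m-1})$ and $p_{n+1}=q=(z_1:\dots:z_{m-1}:1)$. The Weyl group $W_{m,n}$ is the Coxeter group generated by $s_0,\dots,s_{n-1}$ with $s_i^2=1$, $s_is_j=s_js_i$ if nodes $i,j$ are not joined and $s_is_js_i=s_js_is_j$ if they are joined in the tree $T_{2,m,n-m}$ (nodes $1-2-\dots-(n-1)$ form a chain and node $0$ is joined to node $m$). It acts birationally on the right on $\mathbb{X}_{m,n}$: $s_k$ ($1\le k\le n-1$) swaps $p_k,p_{k+1}$, and $[p_1,\dots,p_n].s_0=[p_1,\dots,p_m,\tilde p_{m+1},\dots,\tilde p_n]$ where, in coordinates in which $p_1,\dots,p_m$ are the coordinate points, $\tilde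 p=(x_1^{-1}:\dots:x_m^{-1})$ for $p=(x_1:\dots:x_m)$ (standard Cremona transformation). This induces a left action on rational functions: $w(\varphi)([P])=\varphi([P].w)$. The same construction gives $W_{m,n+1}$ acting on $\mathbb{X}_{m,n+1}$; restricting to $W_{m,n}=\langle s_0,\dots,s_{n-1}\rangle\subset W_{m,n+1}$ gives automorphisms of $\mathbb{C}(u,z)$, and $w(z_i)$ refers to this action. $L_{m,n}=\bigoplus_{j=0}^n\mathbb{Z}e_j$ with symmetric form $\langle e_0,e_0\rangle=-(m-2)$, $\langle e_j,e_j\rangle=1$ ($1\le j\le n$), $\langle e_i,e_j\rangle=0$ ($i\ne j$); $h_0=e_0-e_1-\dots-e_m$, $h_k=e_k-e_{k+1}$; $W_{m,n}$ acts on $L_{m,n}$ by $s_k.\Lambda=\Lambda-\langle h_k,\Lambda\rangle h_k$. $M_{m,n}=W_{m,n}\{e_1,\dots,e_n\}$. Fix nonzero $a_1,\dots,a_m\in\mathcal{K}$ and homogeneous coordinates $x=(x_1,\dots,x_m)$ on $\mathbb{P}^{m-1}(\mathcal{K})$ with $(z_1:\dots:z_{m-1}:1)=(a_1x_1:\dots:a_mx_m)$; the points $p_j$ (with coordinates in $\mathcal{K}$) are expressed in these coordinates. For $\Lambda=de_0-\nu_1e_1-\dots-\nu_ne_n\in L_{m,n}$, $L(\Lambda)$ is the $\mathcal{K}$-vector space of homogeneous polynomials $f\in\mathcal{K}[x]$ of degree $d$ with $\mathrm{ord}_{p_j}f\ge\nu_j$ for $j=1,\dots,n$. *)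

theory Defs
  imports Complex_Main "HOL-Library.Poly_Mapping" "HOL-Library.Nat_Bijection" "HOL-Computational_Algebra.Fraction_Field"
begin

type_synonym mon = "nat \<Rightarrow>\<^sub>0 nat"
type_synonym cpoly = "mon \<Rightarrow>\<^sub>0 complex"
type_synonym fld = "cpoly fract"

definition var :: "nat \<Rightarrow> fld" where
  "var k = Fract (Poly_Mapping.single (Poly_Mapping.single k 1) 1) 1"

definition mvars :: "cpoly \<Rightarrow> nat set" where
  "mvars p = (\<Union>\<alpha>\<in>Poly_Mapping.keys p. Poly_Mapping.keys (\<alpha>::mon))"

definition U :: "nat \<Rightarrow> nat \<Rightarrow> fld" where "U i j = var (prod_encode (i, j))"
definition Z :: "nat \<Rightarrow> fld" where "Z i = var (prod_encode (i, 0))"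

definition Uvars :: "nat \<Rightarrow> nat \<Rightarrow> nat set" where
  "Uvars m n = {prod_encode (i, j) | i j. 1 \<le> i \<and> i \<le> m - 1 \<and> m + 2 \<le> j \<and> j \<le> n}"

definition Kfield :: "nat \<Rightarrow> nat \<Rightarrow> fld set" where
  "Kfield m n = {\<phi>. \<exists>p q. q \<noteq> 0 \<and> \<phi> = Fract p q \<and> mvars p \<subseteq> Uvars m n \<and> mvars q \<subseteq> Uvars m n}"

type_synonym xpoly = "mon \<Rightarrow>\<^sub>0 fld"

definition tdeg :: "mon \<Rightarrow> nat" where "tdeg \<alpha> = (\<Sum>i\<in>Poly_Mapping.keys \<alpha>. Poly_Mapping.lookup \<alpha> i)"

definition Xv :: "nat \<Rightarrow> xpoly" where "Xv i = Poly_Mapping.single (Poly_Mapping.single i 1) 1"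
definition Cst :: "fld \<Rightarrow> xpoly" where "Cst c = Poly_Mapping.single 0 c"

definition smult_x :: "fld \<Rightarrow> xpoly \<Rightarrow> xpoly" where "smult_x c f = Cst c * f"

definition eval_x :: "xpoly \<Rightarrow> (nat \<Rightarrow> fld) \<Rightarrow> fld" where
  "eval_x f x = (\<Sum>\<alpha>\<in>Poly_Mapping.keys f. Poly_Mapping.lookup f \<alpha> * (\<Prod>i\<in>Poly_Mapping.keys \<alpha>. x i ^ Poly_Mapping.lookup \<alpha> i))"

definition translate :: "xpoly \<Rightarrow> (nat \<Rightarrow> fld) \<Rightarrow> xpoly" where
  "translate f p = (\<Sum>\<alpha>\<in>Poly_Mapping.keys f. Cst (Poly_Mapping.lookup f \<alpha>) * (\<Prod>i\<in>Poly_Mapping.keys \<alpha>. (Cst (p i) + Xv i) ^ Poly_Mapping.lookup \<alpha> i))"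

text \<open>ord_p f \<ge> \<nu> (p a representative of a projective point in the affine cone).\<close>
definition ord_ge :: "xpoly \<Rightarrow> (nat \<Rightarrow> fld) \<Rightarrow> int \<Rightarrow> bool" where
  "ord_ge f p \<nu> \<longleftrightarrow> (\<forall>\<beta>\<in>Poly_Mapping.keys (translate f p). \<nu> \<le> int (tdeg \<beta>))"

definition Kpoly :: "nat \<Rightarrow> nat \<Rightarrow> xpoly \<Rightarrow> bool" where
  "Kpoly m n f \<longleftrightarrow> (\<forall>\<alpha>\<in>Poly_Mapping.keys f. Poly_Mapping.lookup f \<alpha> \<in> Kfield m n \<and> Poly_Mapping.keys \<alpha> \<subseteq> {1..m})"

definition homog :: "xpoly \<Rightarrow> int \<Rightarrow> bool" where
  "homog f d \<longleftrightarrow> (\<forall>\<alpha>\<in>Poly_Mapping.keys f. int (tdeg \<alpha>) = d)"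

text \<open>The points p_j in the coordinates x, where (z_1:...:z_{m-1}:1) = (a_1 x_1:...:a_m x_m).\<close>
definition pt :: "nat \<Rightarrow> (nat \<Rightarrow> fld) \<Rightarrow> nat \<Rightarrow> nat \<Rightarrow> fld" where
  "pt m a j i =
     (if j \<le> m then (if i = j then 1 else 0)
      else if j = m + 1 then inverse (a i)
      else (if i = m then 1 else U i j) / a i)"

text \<open>Lattice elements \<Lambda> = \<Sum> \<Lambda>(j) e_j, so \<Lambda> = d e_0 - \<Sum> \<nu>_j e_j means d = \<Lambda> 0, \<nu>_j = - \<Lambda> j.\<close>
definition Lsp :: "nat \<Rightarrow> nat \<Rightarrow> (nat \<Rightarrow> fld) \<Rightarrow> (nat \<Rightarrow> int) \<Rightarrow> xpoly set" where
  "Lsp m n a \<Lambda> = {f. Kpoly m n f \<and> homog f (\<Lambda> 0) \<and> (\<forall>j\<in>{1..n}. ord_ge f (pt m a j) (- \<Lambda> j))}"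

definition Kspan :: "nat \<Rightarrow> nat \<Rightarrow> xpoly set \<Rightarrow> xpoly set" where
  "Kspan m n B = {(\<Sum>b\<in>B. smult_x (c b) b) | c. \<forall>b\<in>B. c b \<in> Kfield m n}"

definition Kindep :: "nat \<Rightarrow> nat \<Rightarrow> xpoly set \<Rightarrow> bool" where
  "Kindep m n B \<longleftrightarrow> (\<forall>c. (\<forall>b\<in>B. c b \<in> Kfield m n) \<longrightarrow> (\<Sum>b\<in>B. smult_x (c b) b) = 0 \<longrightarrow> (\<forall>b\<in>B. c b = 0))"

definition has_Kdim :: "nat \<Rightarrow> nat \<Rightarrow> xpoly set \<Rightarrow> nat \<Rightarrow> bool" where
  "has_Kdim m n S k \<longleftrightarrow> (\<exists>B. B \<subseteq> S \<and> finite B \<and> card B = k \<and> Kindep m n B \<and> S \<subseteq> Kspan m n B)"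

definition e :: "nat \<Rightarrow> nat \<Rightarrow> int" where "e k = (\<lambda>i. if i = k then 1 else 0)"

definition bil :: "nat \<Rightarrow> nat \<Rightarrow> (nat \<Rightarrow> int) \<Rightarrow> (nat \<Rightarrow> int) \<Rightarrow> int" where
  "bil m n \<Lambda> \<Lambda>' = - (int m - 2) * \<Lambda> 0 * \<Lambda>' 0 + (\<Sum>j=1..n. \<Lambda> j * \<Lambda>' j)"

definition hroot :: "nat \<Rightarrow> nat \<Rightarrow> nat \<Rightarrow> int" where
  "hroot m k = (if k = 0 then (\<lambda>i. if i = 0 then 1 else if 1 \<le> i \<and> i \<le> m then -1 else 0)
                else (\<lambda>i. e k i - e (k + 1) i))"

definition refl_L :: "nat \<Rightarrow> nat \<Rightarrow> nat \<Rightarrow> (nat \<Rightarrow> int) \<Rightarrow> (nat \<Rightarrow> int)" where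
  "refl_L m n k \<Lambda> = (\<lambda>i. \<Lambda> i - bil m n (hroot m k) \<Lambda> * hroot m k i)"

text \<open>A word [k1,...,kr] stands for w = s_{k1} ... s_{kr}; left action on the lattice.\<close>
fun act_L :: "nat \<Rightarrow> nat \<Rightarrow> nat list \<Rightarrow> (nat \<Rightarrow> int) \<Rightarrow> (nat \<Rightarrow> int)" where
  "act_L m n [] \<Lambda> = \<Lambda>"
| "act_L m n (k # ks) \<Lambda> = refl_L m n k (act_L m n ks \<Lambda>)"

definition Mset :: "nat \<Rightarrow> nat \<Rightarrow> (nat \<Rightarrow> int) set" where
  "Mset m n = {act_L m n w (e i) | w i. w \<in> lists {0..<n} \<and> 1 \<le> i \<and> i \<le> n}"

text \<open>A configuration C: C j i is the i-th normalized coordinate (1 \<le> i \<le> m-1) of p_j,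
  m+2 \<le> j \<le> n+1 (p_{n+1} = q); p_1..p_m are the coordinate points, p_{m+1} = (1:...:1),
  and p_j = (C j 1 : ... : C j (m-1) : 1).  cfg_step k C gives the coordinates of [P].s_k.\<close>
definition cfg_step :: "nat \<Rightarrow> nat \<Rightarrow> (nat \<Rightarrow> nat \<Rightarrow> fld) \<Rightarrow> (nat \<Rightarrow> nat \<Rightarrow> fld)" where
  "cfg_step m k C =
    (if k = 0 then (\<lambda>j i. inverse (C j i))
     else if k < m - 1 then
       (\<lambda>j i. if i = k then C j (k + 1) else if i = k + 1 then C j k else C j i)
     else if k = m - 1 then
       (\<lambda>j i. if i = m - 1 then inverse (C j (m - 1)) else C j i / C j (m - 1))
     else if k = m then (\<lambda>j i. 1 - C j i)
     else if k = m + 1 then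
       (\<lambda>j i. if j = m + 2 then inverse (C (m + 2) i) else C j i / C (m + 2) i)
     else
       (\<lambda>j i. if j = k then C (k + 1) i else if j = k + 1 then C k i else C j i))"

fun cfg_act :: "nat \<Rightarrow> nat list \<Rightarrow> (nat \<Rightarrow> nat \<Rightarrow> fld) \<Rightarrow> (nat \<Rightarrow> nat \<Rightarrow> fld)" where
  "cfg_act m [] C = C"
| "cfg_act m (k # ks) C = cfg_act m ks (cfg_step m k C)"

definition gen_cfg :: "nat \<Rightarrow> nat \<Rightarrow> nat \<Rightarrow> fld" where
  "gen_cfg n j i = (if j = n + 1 then Z i else U i j)"

text \<open>w(z_i) for the word w: (w \<phi>)([P]) = \<phi>([P].w).\<close>
definition wz :: "nat \<Rightarrow> nat \<Rightarrow> nat list \<Rightarrow> nat \<Rightarrow> fld" where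
  "wz m n w i = cfg_act m w (gen_cfg n) (n + 1) i"

definition proj_eq :: "nat \<Rightarrow> (nat \<Rightarrow> fld) \<Rightarrow> (nat \<Rightarrow> fld) \<Rightarrow> bool" where
  "proj_eq m v w \<longleftrightarrow> (\<exists>t. t \<noteq> 0 \<and> (\<forall>i\<in>{1..m}. v i = t * w i))"

end

theory Submission
  imports Defs "HOL-Computational_Algebra.Formal_Power_Series"
begin

text \<open>
  Everything is done for an arbitrary configuration \<open>C\<close> over the fixed field instead of the generic one. If
  \<open>C' = C.s\<^sub>k\<close>, then pulling back polynomials along the linear or Cremona map that relates the two
  configurations is a linear isomorphism from \<open>L(\<Lambda>)\<close> for \<open>C'\<close> to \<open>L(s\<^sub>k\<Lambda>)\<close> for \<open>C\<close>, and it multiplies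
  the values at \<open>q\<close> by a factor \<open>u(\<Lambda>)\<close> that is a homomorphism in \<open>\<Lambda>\<close>. Induction on the word \<open>w\<close> reduces both
  claims to \<open>w = 1\<close>, where \<open>L(e\<^sub>i)\<close> consists of the constants and \<open>L(s\<^sub>0e\<^sub>i)\<close> is spanned by \<open>x\<^sub>i\<close>; the
  factors \<open>u(w s\<^sub>0 e\<^sub>i) / u(w e\<^sub>i) = u(w h\<^sub>0)\<close> do not depend on \<open>i\<close> and disappear projectively.

  Two points need care. The order of vanishing at \<open>p\<close> is tested on formal curves through \<open>p\<close>, which makes its
  invariance under both kinds of maps immediate. And no coordinate may vanish anywhere along the orbit of the
  generic configuration: each generator acts on the generic coordinates by a rational involution, hence extends to
  an injective endomorphism of the function field.
\<close>

abbreviation keys :: "('a \<Rightarrow>\<^sub>0 'b::zero) \<Rightarrow> 'a set" where "keys \<equiv> Poly_Mapping.keys"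
abbreviation lookup :: "('a \<Rightarrow>\<^sub>0 'b::zero) \<Rightarrow> 'a \<Rightarrow> 'b" where "lookup \<equiv> Poly_Mapping.lookup"
abbreviation single :: "'a \<Rightarrow> 'b \<Rightarrow> 'a \<Rightarrow>\<^sub>0 'b::zero" where "single \<equiv> Poly_Mapping.single"

section \<open>Evaluation of polynomials in commutative rings\<close>

definition mono_eval :: "(nat \<Rightarrow> 'b::comm_ring_1) \<Rightarrow> mon \<Rightarrow> 'b" where
  "mono_eval x \<alpha> = (\<Prod>i\<in>keys \<alpha>. x i ^ lookup \<alpha> i)"

text \<open>The coefficient map \<open>h\<close> lets one evaluation serve every purpose:
  \<open>h\<close> is the identity for values at points, \<open>Cst\<close> for substituting
  polynomials, \<open>cst\<close> for formal curves, and \<open>cemb\<close> for rational functions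
  with complex coefficients.\<close>

definition peval :: "('a::comm_ring_1 \<Rightarrow> 'b::comm_ring_1) \<Rightarrow> (mon \<Rightarrow>\<^sub>0 'a) \<Rightarrow> (nat \<Rightarrow> 'b) \<Rightarrow> 'b" where
  "peval h f x = (\<Sum>\<alpha>\<in>keys f. h (lookup f \<alpha>) * mono_eval x \<alpha>)"

definition is_hom :: "('a::comm_ring_1 \<Rightarrow> 'b::comm_ring_1) \<Rightarrow> bool" where
  "is_hom h \<longleftrightarrow> h 0 = 0 \<and> h 1 = 1 \<and> (\<forall>x y. h (x + y) = h x + h y) \<and> (\<forall>x y. h (x * y) = h x * h y)"

lemma is_homD:
  assumes "is_hom h"
  shows "h 0 = 0" "h 1 = 1" "h (x + y) = h x + h y" "h (x * y) = h x * h y"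
  using assms by (auto simp: is_hom_def)

lemma is_hom_sum: "is_hom h \<Longrightarrow> h (sum f A) = (\<Sum>a\<in>A. h (f a))"
  by (induction A rule: infinite_finite_induct) (auto simp: is_homD)

lemma is_hom_prod: "is_hom h \<Longrightarrow> h (prod f A) = (\<Prod>a\<in>A. h (f a))"
  by (induction A rule: infinite_finite_induct) (auto simp: is_homD)

lemma is_hom_power: "is_hom h \<Longrightarrow> h (x ^ k) = h x ^ k"
  by (induction k) (auto simp: is_homD)

lemma is_hom_minus: "is_hom h \<Longrightarrow> h (- x) = - h x"
  by (metis ab_left_minus add.commute is_homD(1,3) neg_eq_iff_add_eq_0 minus_minus)

lemma is_hom_diff: "is_hom h \<Longrightarrow> h (x - y) = h x - h y"
  using is_homD(3)[of h x "- y"] is_hom_minus[of h y] by simp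

lemma is_hom_comp: "is_hom g \<Longrightarrow> is_hom h \<Longrightarrow> is_hom (\<lambda>x. g (h x))"
  by (auto simp: is_hom_def)

lemma is_hom_id: "is_hom (\<lambda>c. c)"
  by (auto simp: is_hom_def)

lemma is_hom_single0: "is_hom (\<lambda>c. single (0::mon) c)"
  by (auto simp: is_hom_def single_add mult_single)

lemma is_hom_Cst: "is_hom Cst"
  using is_hom_single0 by (simp add: Cst_def[abs_def])

lemma mono_eval_superset:
  assumes "finite A" "keys \<alpha> \<subseteq> A"
  shows "mono_eval x \<alpha> = (\<Prod>i\<in>A. x i ^ lookup \<alpha> i)"
  unfolding mono_eval_def
  by (rule prod.mono_neutral_left) (use assms in \<open>auto simp: in_keys_iff\<close>)

lemma mono_eval_0 [simp]: "mono_eval x 0 = 1"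
  by (simp add: mono_eval_def)

lemma mono_eval_single [simp]: "mono_eval x (single k n) = x k ^ n"
  by (auto simp: mono_eval_def)

lemma mono_eval_add: "mono_eval x (\<alpha> + \<beta>) = mono_eval x \<alpha> * mono_eval x \<beta>"
proof -
  let ?A = "keys \<alpha> \<union> keys \<beta>"
  have "mono_eval x (\<alpha> + \<beta>) = (\<Prod>i\<in>?A. x i ^ lookup (\<alpha> + \<beta>) i)"
    by (rule mono_eval_superset) (auto simp: keys_add[THEN subsetD] dest: keys_add[THEN subsetD])
  also have "\<dots> = (\<Prod>i\<in>?A. x i ^ lookup \<alpha> i) * (\<Prod>i\<in>?A. x i ^ lookup \<beta> i)"
    by (simp add: lookup_add power_add prod.distrib)
  also have "\<dots> = mono_eval x \<alpha> * mono_eval x \<beta>"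
    by (simp add: mono_eval_superset[of ?A])
  finally show ?thesis .
qed

lemma mono_eval_mult: "mono_eval (\<lambda>i. x i * y i) \<alpha> = mono_eval x \<alpha> * mono_eval y \<alpha>"
  by (simp add: mono_eval_def power_mult_distrib prod.distrib)

lemma mono_eval_hom: "is_hom h \<Longrightarrow> h (mono_eval x \<alpha>) = mono_eval (\<lambda>i. h (x i)) \<alpha>"
  by (simp add: mono_eval_def is_hom_prod is_hom_power)

lemma mono_eval_cong: "(\<And>i. i \<in> keys \<alpha> \<Longrightarrow> x i = y i) \<Longrightarrow> mono_eval x \<alpha> = mono_eval y \<alpha>"
  by (simp add: mono_eval_def)

lemma mono_eval_const: "mono_eval (\<lambda>_. c) \<alpha> = c ^ tdeg \<alpha>"
  by (simp add: mono_eval_def tdeg_def power_sum)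

lemma tdeg_superset:
  assumes "finite A" "keys \<alpha> \<subseteq> A"
  shows "tdeg \<alpha> = (\<Sum>i\<in>A. lookup \<alpha> i)"
  unfolding tdeg_def by (rule sum.mono_neutral_left) (use assms in \<open>auto simp: in_keys_iff\<close>)

lemma tdeg_add: "tdeg (\<alpha> + \<beta>) = tdeg \<alpha> + tdeg \<beta>"
proof -
  let ?A = "keys \<alpha> \<union> keys \<beta>"
  have "tdeg (\<alpha> + \<beta>) = (\<Sum>i\<in>?A. lookup (\<alpha> + \<beta>) i)"
    by (rule tdeg_superset) (auto dest: keys_add[THEN subsetD])
  then show ?thesis
    by (simp add: lookup_add sum.distrib tdeg_superset[of ?A])
qed

lemma poly_sum_monomials: "f = (\<Sum>\<alpha>\<in>keys f. single \<alpha> (lookup f \<alpha>))"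
proof (rule poly_mapping_eqI)
  fix k
  have "(\<Sum>\<alpha>\<in>keys f. lookup (single \<alpha> (lookup f \<alpha>)) k) = (\<Sum>\<alpha>\<in>keys f. if k = \<alpha> then lookup f \<alpha> else 0)"
    by (rule sum.cong) (auto simp: lookup_single)
  also have "\<dots> = lookup f k"
    by (auto simp: sum.delta in_keys_iff)
  finally show "lookup f k = lookup (\<Sum>\<alpha>\<in>keys f. single \<alpha> (lookup f \<alpha>)) k"
    by (simp add: lookup_sum)
qed

lemma poly_add_induct [case_names zero single add]:
  assumes "P 0" "\<And>\<alpha> c. P (single \<alpha> c)" "\<And>f g. P f \<Longrightarrow> P g \<Longrightarrow> P (f + g)"
  shows "P (f :: 'c \<Rightarrow>\<^sub>0 'a::comm_monoid_add)"
proof -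
  have "P (\<Sum>\<alpha>\<in>A. single \<alpha> (lookup f \<alpha>))" if "finite A" for A
    using that by (induction A) (auto intro: assms)
  from this[of "keys f"] show ?thesis
    by (simp flip: poly_sum_monomials)
qed

lemma peval_superset:
  assumes "finite A" "keys f \<subseteq> A" "h 0 = 0"
  shows "peval h f x = (\<Sum>\<alpha>\<in>A. h (lookup f \<alpha>) * mono_eval x \<alpha>)"
  unfolding peval_def by (rule sum.mono_neutral_left) (use assms in \<open>auto simp: in_keys_iff\<close>)

lemma peval_single: "h 0 = 0 \<Longrightarrow> peval h (single \<alpha> c) x = h c * mono_eval x \<alpha>"
  by (auto simp: peval_def)

lemma peval_0 [simp]: "peval h 0 x = 0"
  by (simp add: peval_def)

lemma peval_add:
  assumes "is_hom h"
  shows "peval h (f + g) x = peval h f x + peval h g x"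
proof -
  let ?A = "keys f \<union> keys g"
  have "peval h (f + g) x = (\<Sum>\<alpha>\<in>?A. h (lookup (f + g) \<alpha>) * mono_eval x \<alpha>)"
    by (rule peval_superset) (auto simp: assms is_homD dest: keys_add[THEN subsetD])
  then show ?thesis
    by (simp add: lookup_add sum.distrib peval_superset[of ?A] assms is_homD distrib_right)
qed

lemma peval_mult:
  assumes h: "is_hom h"
  shows "peval h (f * g) x = peval h f x * peval h g x"
proof (induction f rule: poly_add_induct)
  case (single \<alpha> c)
  show ?case
  proof (induction g rule: poly_add_induct)
    case (single \<beta> d)
    show ?case using h
      by (simp add: mult_single peval_single is_homD mono_eval_add mult_ac)
  qed (simp_all add: distrib_left peval_add h)
qed (simp_all add: distrib_right peval_add h)

lemma peval_1: "is_hom h \<Longrightarrow> peval h 1 x = 1"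
  using peval_single[of h 0 1 x] by (simp add: is_homD)

lemma is_hom_peval: "is_hom h \<Longrightarrow> is_hom (\<lambda>f. peval h f x)"
  by (auto simp: is_hom_def peval_mult peval_add peval_1 intro: is_homD)

lemma peval_Xv: "is_hom h \<Longrightarrow> peval h (Xv i) x = x i"
  by (simp add: Xv_def peval_single is_homD)

lemma peval_Cst: "is_hom h \<Longrightarrow> peval h (Cst c) x = h c"
  by (simp add: Cst_def peval_single is_homD)

lemma peval_hom: "is_hom g \<Longrightarrow> g (peval h f x) = peval (\<lambda>c. g (h c)) f (\<lambda>i. g (x i))"
  by (simp add: peval_def is_hom_sum is_homD mono_eval_hom)

lemma peval_cong:
  assumes "\<And>\<alpha> i. \<alpha> \<in> keys f \<Longrightarrow> i \<in> keys \<alpha> \<Longrightarrow> x i = y i"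
  shows "peval h f x = peval h f y"
  unfolding peval_def by (intro sum.cong refl arg_cong2[of _ _ _ _ "(*)"] mono_eval_cong) (use assms in auto)

lemma mono_eval_vars: "mono_eval (\<lambda>i. single (single i 1) 1) \<alpha> = (single \<alpha> 1 :: mon \<Rightarrow>\<^sub>0 'a::comm_ring_1)"
proof -
  have pw: "(single (single i 1) 1 :: mon \<Rightarrow>\<^sub>0 'a) ^ k = single (single i k) 1" for i k
    by (induction k) (auto simp: mult_single single_add[symmetric] simp flip: single_one)
  have "finite A \<Longrightarrow> (\<Prod>i\<in>A. (single (single i 1) 1 :: mon \<Rightarrow>\<^sub>0 'a) ^ lookup \<alpha> i)
      = single (\<Sum>i\<in>A. single i (lookup \<alpha> i)) 1" for A
    by (induction A rule: finite_induct) (auto simp: pw[simplified] mult_single)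
  from this[of "keys \<alpha>"] show ?thesis
    by (simp add: mono_eval_def flip: poly_sum_monomials)
qed

lemma mono_eval_Xv: "mono_eval Xv \<alpha> = single \<alpha> 1"
  using mono_eval_vars by (simp add: Xv_def[abs_def])

lemma peval_Cst_Xv: "peval Cst f Xv = f"
  by (subst (2) poly_sum_monomials) (simp add: peval_def mono_eval_Xv Cst_def mult_single)

text \<open>Evaluation is itself a homomorphism, so it passes through the outer substitution.
  Identities between substitutions thereby reduce to the images of the variables.\<close>

lemma peval_peval:
  assumes "is_hom h"
  shows "peval h (peval Cst f y) x = peval h f (\<lambda>i. peval h (y i) x)"
  using peval_hom[OF is_hom_peval[OF assms], of Cst f y x] assms by (simp add: peval_Cst)

lemma eval_x_eq_peval: "eval_x f x = peval (\<lambda>c. c) f x"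
  by (simp add: eval_x_def peval_def mono_eval_def)

lemma translate_eq_peval: "translate f p = peval Cst f (\<lambda>i. Cst (p i) + Xv i)"
  by (simp add: translate_def peval_def mono_eval_def)

section \<open>The field of rational functions of the configuration\<close>

lemma mvars_add: "mvars (p + q) \<subseteq> mvars p \<union> mvars q"
  unfolding mvars_def using keys_add[of p q] by blast

lemma mvars_mult: "mvars (p * q) \<subseteq> mvars p \<union> mvars q"
proof
  fix i assume "i \<in> mvars (p * q)"
  then obtain \<alpha> where "\<alpha> \<in> keys (p * q)" "i \<in> keys \<alpha>"
    by (auto simp: mvars_def)
  then obtain \<beta> \<gamma> where "\<beta> \<in> keys p" "\<gamma> \<in> keys q" "\<alpha> = \<beta> + \<gamma>"
    using keys_mult[of p q] by blast
  then show "i \<in> mvars p \<union> mvars q"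
    using \<open>i \<in> keys \<alpha>\<close> keys_add[of \<beta> \<gamma>] by (auto simp: mvars_def)
qed

lemma KfieldI: "q \<noteq> 0 \<Longrightarrow> mvars p \<subseteq> Uvars m n \<Longrightarrow> mvars q \<subseteq> Uvars m n \<Longrightarrow> Fract p q \<in> Kfield m n"
  unfolding Kfield_def by blast

lemma KfieldE:
  assumes "x \<in> Kfield m n"
  obtains p q where "q \<noteq> 0" "x = Fract p q" "mvars p \<subseteq> Uvars m n" "mvars q \<subseteq> Uvars m n"
  using assms unfolding Kfield_def by blast

lemma mvars_0 [simp]: "mvars 0 = {}" and mvars_1 [simp]: "mvars 1 = {}"
  by (auto simp: mvars_def)

lemma mvars_uminus [simp]: "mvars (- p) = mvars p"
  by (auto simp: mvars_def in_keys_iff)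

lemma Kfield_0 [simp]: "0 \<in> Kfield m n"
  using KfieldI[of 1 0 m n] by (simp add: Zero_fract_def)

lemma Kfield_1 [simp]: "1 \<in> Kfield m n"
  using KfieldI[of 1 1 m n] by (simp add: One_fract_def)

lemma Kfield_add:
  assumes "x \<in> Kfield m n" "y \<in> Kfield m n" shows "x + y \<in> Kfield m n"
proof -
  obtain p q where pq: "q \<noteq> 0" "x = Fract p q" "mvars p \<subseteq> Uvars m n" "mvars q \<subseteq> Uvars m n"
    using assms(1) by (rule KfieldE)
  obtain r s where rs: "s \<noteq> 0" "y = Fract r s" "mvars r \<subseteq> Uvars m n" "mvars s \<subseteq> Uvars m n"
    using assms(2) by (rule KfieldE)
  have "x + y = Fract (p * s + r * q) (q * s)"
    using pq rs by simp
  moreover have "mvars (p * s + r * q) \<subseteq> Uvars m n"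
    using mvars_add[of "p * s" "r * q"] mvars_mult[of p s] mvars_mult[of r q] pq rs by blast
  moreover have "mvars (q * s) \<subseteq> Uvars m n"
    using mvars_mult[of q s] pq rs by blast
  ultimately show ?thesis
    using pq rs by (auto intro!: KfieldI)
qed

lemma Kfield_mult:
  assumes "x \<in> Kfield m n" "y \<in> Kfield m n" shows "x * y \<in> Kfield m n"
proof -
  obtain p q where pq: "q \<noteq> 0" "x = Fract p q" "mvars p \<subseteq> Uvars m n" "mvars q \<subseteq> Uvars m n"
    using assms(1) by (rule KfieldE)
  obtain r s where rs: "s \<noteq> 0" "y = Fract r s" "mvars r \<subseteq> Uvars m n" "mvars s \<subseteq> Uvars m n"
    using assms(2) by (rule KfieldE)
  have "x * y = Fract (p * r) (q * s)"
    using pq rs by simp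
  then show ?thesis
    using pq rs mvars_mult[of p r] mvars_mult[of q s] by (auto intro!: KfieldI)
qed

lemma Kfield_uminus: "x \<in> Kfield m n \<Longrightarrow> - x \<in> Kfield m n"
  by (elim KfieldE) (auto intro!: KfieldI)

lemma Kfield_diff: "x \<in> Kfield m n \<Longrightarrow> y \<in> Kfield m n \<Longrightarrow> x - y \<in> Kfield m n"
  using Kfield_add[of x m n "- y"] Kfield_uminus[of y] by simp

lemma Kfield_inverse: assumes "x \<in> Kfield m n" shows "inverse x \<in> Kfield m n"
proof (cases "x = 0")
  case False
  obtain p q where pq: "q \<noteq> 0" "x = Fract p q" "mvars p \<subseteq> Uvars m n" "mvars q \<subseteq> Uvars m n"
    using assms(1) by (rule KfieldE)
  then have "p \<noteq> 0" using False by (auto simp: fract_collapse)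
  then show ?thesis
    using pq by (auto intro!: KfieldI)
qed simp

lemma Kfield_divide: "x \<in> Kfield m n \<Longrightarrow> y \<in> Kfield m n \<Longrightarrow> x / y \<in> Kfield m n"
  by (simp add: divide_inverse Kfield_mult Kfield_inverse)

lemma var_neq_0: "var k \<noteq> 0"
proof -
  have "(single (single k 1) 1 :: cpoly) \<noteq> 0"
    by (metis lookup_single_eq lookup_zero zero_neq_one)
  then show ?thesis
    by (simp add: var_def Zero_fract_def eq_fract)
qed

lemma U_in_Kfield: "1 \<le> i \<Longrightarrow> i \<le> m - 1 \<Longrightarrow> m + 2 \<le> j \<Longrightarrow> j \<le> n \<Longrightarrow> U i j \<in> Kfield m n"
  unfolding U_def var_def by (rule KfieldI) (auto simp: mvars_def Uvars_def)

section \<open>Homogeneous polynomials over the field\<close>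

lemma times_monomials:
  "f * g = (\<Sum>\<alpha>\<in>keys f. \<Sum>\<beta>\<in>keys g. single (\<alpha> + \<beta>) (lookup f \<alpha> * lookup g \<beta>))"
proof -
  have "f * g = (\<Sum>\<alpha>\<in>keys f. single \<alpha> (lookup f \<alpha>)) * (\<Sum>\<beta>\<in>keys g. single \<beta> (lookup g \<beta>))"
    by (simp flip: poly_sum_monomials)
  then show ?thesis
    by (simp add: sum_product mult_single)
qed

lemma Kpoly_altdef:
  "Kpoly m n f \<longleftrightarrow> (\<forall>\<alpha>. lookup f \<alpha> \<in> Kfield m n \<and> (lookup f \<alpha> \<noteq> 0 \<longrightarrow> keys \<alpha> \<subseteq> {1..m}))"
  unfolding Kpoly_def Ball_def in_keys_iff by (metis Kfield_0)

lemma Kpoly_0 [simp]: "Kpoly m n 0"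
  by (simp add: Kpoly_def)

lemma Kpoly_single: "c \<in> Kfield m n \<Longrightarrow> keys \<alpha> \<subseteq> {1..m} \<Longrightarrow> Kpoly m n (single \<alpha> c)"
  by (auto simp: Kpoly_def)

lemma Kpoly_add: "Kpoly m n f \<Longrightarrow> Kpoly m n g \<Longrightarrow> Kpoly m n (f + g)"
  unfolding Kpoly_altdef by (auto simp: lookup_add Kfield_add) (metis add_0 subsetD atLeastAtMost_iff)+

lemma Kpoly_uminus: "Kpoly m n f \<Longrightarrow> Kpoly m n (- f)"
  unfolding Kpoly_altdef by (auto simp: Kfield_uminus)

lemma Kpoly_diff: "Kpoly m n f \<Longrightarrow> Kpoly m n g \<Longrightarrow> Kpoly m n (f - g)"
  using Kpoly_add[of m n f "- g"] Kpoly_uminus[of m n g] by simp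

lemma Kpoly_sum: "(\<And>a. a \<in> A \<Longrightarrow> Kpoly m n (f a)) \<Longrightarrow> Kpoly m n (sum f A)"
  by (induction A rule: infinite_finite_induct) (auto simp: Kpoly_add)

lemma Kpoly_mult: "Kpoly m n f \<Longrightarrow> Kpoly m n g \<Longrightarrow> Kpoly m n (f * g)"
  unfolding times_monomials
  by (intro Kpoly_sum Kpoly_single Kfield_mult) (auto simp: Kpoly_def dest!: keys_add[THEN subsetD])

lemma Kpoly_Cst: "c \<in> Kfield m n \<Longrightarrow> Kpoly m n (Cst c)"
  unfolding Cst_def by (rule Kpoly_single) auto

lemma Kpoly_Xv: "1 \<le> i \<Longrightarrow> i \<le> m \<Longrightarrow> Kpoly m n (Xv i)"
  unfolding Xv_def by (rule Kpoly_single) auto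

lemma Kpoly_power: "Kpoly m n f \<Longrightarrow> Kpoly m n (f ^ k)"
  using Kpoly_Cst[of 1 m n] by (induction k) (auto simp: Kpoly_mult Cst_def)

lemma Kpoly_prod: "(\<And>a. a \<in> A \<Longrightarrow> Kpoly m n (f a)) \<Longrightarrow> Kpoly m n (prod f A)"
  using Kpoly_Cst[of 1 m n] by (induction A rule: infinite_finite_induct) (auto simp: Kpoly_mult Cst_def)

lemma Kpoly_peval:
  assumes "Kpoly m n f" "\<And>i. i \<in> {1..m} \<Longrightarrow> Kpoly m n (g i)"
  shows "Kpoly m n (peval Cst f g)"
  unfolding peval_def mono_eval_def
  by (intro Kpoly_sum Kpoly_mult Kpoly_prod Kpoly_power Kpoly_Cst assms(2))
     (use assms(1) in \<open>unfold Kpoly_def, blast+\<close>)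

section \<open>Homogeneity\<close>

lemma homog_altdef: "homog f d \<longleftrightarrow> (\<forall>\<alpha>. lookup f \<alpha> \<noteq> 0 \<longrightarrow> int (tdeg \<alpha>) = d)"
  by (auto simp: homog_def in_keys_iff)

lemma homog_0 [simp]: "homog 0 d"
  by (simp add: homog_def)

lemma homog_single: "d = int (tdeg \<alpha>) \<Longrightarrow> homog (single \<alpha> c) d"
  by (auto simp: homog_def)

lemma homog_add: "homog f d \<Longrightarrow> homog g d \<Longrightarrow> homog (f + g) d"
  unfolding homog_altdef by (metis add_0 lookup_add)

lemma homog_uminus: "homog f d \<Longrightarrow> homog (- f) d"
  unfolding homog_altdef by auto

lemma homog_diff: "homog f d \<Longrightarrow> homog g d \<Longrightarrow> homog (f - g) d"
  using homog_add[of f d "- g"] homog_uminus[of g d] by simp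

lemma homog_sum: "(\<And>a. a \<in> A \<Longrightarrow> homog (f a) d) \<Longrightarrow> homog (sum f A) d"
  by (induction A rule: infinite_finite_induct) (auto simp: homog_add)

lemma homog_mult: "homog f d \<Longrightarrow> homog g d' \<Longrightarrow> homog (f * g) (d + d')"
  unfolding times_monomials
  by (intro homog_sum homog_single) (auto simp: homog_def tdeg_add)

lemma tdeg_0 [simp]: "tdeg 0 = 0"
  by (simp add: tdeg_def)

lemma tdeg_single [simp]: "tdeg (single i k) = k"
  by (auto simp: tdeg_def)

lemma homog_Cst: "homog (Cst c) 0"
  unfolding Cst_def by (rule homog_single) auto

lemma homog_Xv: "homog (Xv i) 1"
  unfolding Xv_def by (rule homog_single) auto

lemma homog_1: "homog 1 0"
  using homog_Cst[of 1] by (simp add: Cst_def)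

lemma homog_power: "homog f 1 \<Longrightarrow> homog (f ^ k) (int k)"
  by (induction k) (auto simp: homog_1 dest: homog_mult)

lemma homog_prod: "(\<And>a. a \<in> A \<Longrightarrow> homog (f a) (int (d a))) \<Longrightarrow> homog (prod f A) (int (sum d A))"
  by (induction A rule: infinite_finite_induct) (auto simp: homog_1 homog_mult)

lemma homog_mono_eval: "(\<And>i. i \<in> keys \<alpha> \<Longrightarrow> homog (g i) 1) \<Longrightarrow> homog (mono_eval g \<alpha>) (int (tdeg \<alpha>))"
  unfolding mono_eval_def tdeg_def by (intro homog_prod homog_power)

lemma homog_peval:
  assumes "homog f d" "\<And>\<alpha> i. \<alpha> \<in> keys f \<Longrightarrow> i \<in> keys \<alpha> \<Longrightarrow> homog (g i) 1"
  shows "homog (peval Cst f g) d"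
  unfolding peval_def
proof (rule homog_sum)
  fix \<alpha> assume a: "\<alpha> \<in> keys f"
  have "homog (Cst (lookup f \<alpha>) * mono_eval g \<alpha>) (0 + int (tdeg \<alpha>))"
    by (intro homog_mult homog_Cst homog_mono_eval assms(2)[OF a])
  then show "homog (Cst (lookup f \<alpha>) * mono_eval g \<alpha>) d"
    using assms(1) a by (simp add: homog_def)
qed

text \<open>Homogeneity is what makes evaluation at representatives of projective points usable: a
  change of representative costs only a power of the scalar.\<close>

lemma peval_scale:
  assumes "homog f d"
  shows "peval h f (\<lambda>i. c * x i) = c ^ nat d * peval h f x"
proof -
  have "peval h f (\<lambda>i. c * x i) = (\<Sum>\<alpha>\<in>keys f. c ^ nat d * (h (lookup f \<alpha>) * mono_eval x \<alpha>))"
    unfolding peval_def using assms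
    by (intro sum.cong) (auto simp: mono_eval_mult mono_eval_const homog_def)
  then show ?thesis
    by (simp add: peval_def sum_distrib_left)
qed

section \<open>Vanishing orders along formal curves\<close>

unbundle fps_syntax

text \<open>Curves have coefficients in the fraction field of \<open>xpoly\<close>, so that the generic line \<open>p + t x\<close> is one
  of them and detects the order of vanishing.\<close>
type_synonym bigfld = "xpoly fract"

definition embE :: "xpoly \<Rightarrow> bigfld" where "embE f = Fract f 1"

definition cst :: "fld \<Rightarrow> bigfld fps" where "cst c = fps_const (embE (Cst c))"

lemma is_hom_embE: "is_hom embE"
  by (auto simp: is_hom_def embE_def Zero_fract_def One_fract_def)

lemma embE_eq_0_iff: "embE f = 0 \<longleftrightarrow> f = 0"
  by (simp add: embE_def Zero_fract_def eq_fract)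

lemma Cst_eq_0_iff: "Cst c = 0 \<longleftrightarrow> c = 0"
  by (metis Cst_def lookup_single_eq single_zero lookup_zero)

lemma is_hom_fps_const: "is_hom fps_const"
  by (auto simp: is_hom_def)

lemma is_hom_cst: "is_hom cst"
  using is_hom_comp[OF is_hom_fps_const is_hom_comp[OF is_hom_embE is_hom_Cst]]
  by (simp add: cst_def[abs_def])

lemma cst_nth_0: "cst c $ 0 = embE (Cst c)"
  by (simp add: cst_def)

section \<open>Weighted degrees and generic weighted curves\<close>

definition wdeg :: "(nat \<Rightarrow> nat) \<Rightarrow> mon \<Rightarrow> nat" where
  "wdeg w \<alpha> = (\<Sum>i\<in>keys \<alpha>. w i * lookup \<alpha> i)"

lemma mono_eval_weights: "mono_eval (\<lambda>i. c ^ w i) \<alpha> = c ^ wdeg w \<alpha>"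
  by (simp add: mono_eval_def wdeg_def power_sum power_mult)

lemma wdeg_1: "wdeg (\<lambda>_. 1) \<alpha> = tdeg \<alpha>"
  by (simp add: wdeg_def tdeg_def)

lemma wdeg_omit: "wdeg (\<lambda>i. if i = j then 0 else 1) \<alpha> + lookup \<alpha> j = tdeg \<alpha>"
proof -
  let ?A = "insert j (keys \<alpha>)"
  have "wdeg (\<lambda>i. if i = j then 0 else 1) \<alpha> = (\<Sum>i\<in>?A. (if i = j then 0 else 1) * lookup \<alpha> i)"
    unfolding wdeg_def by (rule sum.mono_neutral_left) (auto simp: in_keys_iff)
  also have "\<dots> = (\<Sum>i\<in>?A - {j}. lookup \<alpha> i)"
    by (rule sum.mono_neutral_cong_right) auto
  also have "\<dots> + lookup \<alpha> j = (\<Sum>i\<in>?A. lookup \<alpha> i)"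
    by (subst (2) sum.remove[of _ j]) auto
  finally show ?thesis
    using tdeg_superset[of ?A \<alpha>] by (simp add: subset_insertI)
qed

text \<open>Along the curve with coordinates \<open>t^(w i) * x_i\<close> a monomial acquires
  exactly the factor t to its weight. The \<open>x_i\<close> stay independent, so distinct monomials
  of equal weight cannot cancel.\<close>

lemma weighted_curve_nth:
  "peval cst g (\<lambda>i. fps_X ^ w i * fps_const (embE (Xv i))) $ k =
     embE (\<Sum>\<alpha>\<in>{\<alpha>\<in>keys g. wdeg w \<alpha> = k}. single \<alpha> (lookup g \<alpha>))"
proof -
  have *: "(cst c * mono_eval (\<lambda>i. fps_X ^ w i * fps_const (embE (Xv i))) \<alpha>) $ k =
      (if wdeg w \<alpha> = k then embE (single \<alpha> c) else 0)" for c \<alpha>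
  proof -
    have "mono_eval (\<lambda>i. fps_const (embE (Xv i))) \<alpha> = fps_const (embE (single \<alpha> 1))"
      using mono_eval_hom[OF is_hom_comp[OF is_hom_fps_const is_hom_embE], of Xv \<alpha>]
      by (simp add: mono_eval_Xv)
    then have "cst c * mono_eval (\<lambda>i. fps_X ^ w i * fps_const (embE (Xv i))) \<alpha> =
        fps_const (embE (Cst c * single \<alpha> 1)) * fps_X ^ wdeg w \<alpha>"
      by (simp add: mono_eval_mult mono_eval_weights cst_def is_homD[OF is_hom_embE] mult_ac
               flip: fps_const_mult)
    then show ?thesis
      by (simp add: fps_X_power_mult_right_nth Cst_def mult_single)
  qed
  have "peval cst g (\<lambda>i. fps_X ^ w i * fps_const (embE (Xv i))) $ k =
     (\<Sum>\<alpha>\<in>keys g. if wdeg w \<alpha> = k then embE (single \<alpha> (lookup g \<alpha>)) else 0)"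
    by (simp add: peval_def fps_sum_nth *)
  also have "\<dots> = (\<Sum>\<alpha>\<in>{\<alpha>\<in>keys g. wdeg w \<alpha> = k}. embE (single \<alpha> (lookup g \<alpha>)))"
    by (simp add: sum.inter_filter)
  finally show ?thesis
    by (simp add: is_hom_sum[OF is_hom_embE])
qed

lemma weighted_curve_dvd:
  assumes "fps_X ^ N dvd peval cst g (\<lambda>i. fps_X ^ w i * fps_const (embE (Xv i)))" "\<alpha> \<in> keys g"
  shows "N \<le> wdeg w \<alpha>"
proof (rule ccontr)
  assume "\<not> N \<le> wdeg w \<alpha>"
  let ?k = "wdeg w \<alpha>"
  let ?S = "\<Sum>\<alpha>\<in>{\<alpha>\<in>keys g. wdeg w \<alpha> = ?k}. single \<alpha> (lookup g \<alpha>)"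
  obtain h where "peval cst g (\<lambda>i. fps_X ^ w i * fps_const (embE (Xv i))) = fps_X ^ N * h"
    using assms(1) by (elim dvdE)
  then have "peval cst g (\<lambda>i. fps_X ^ w i * fps_const (embE (Xv i))) $ ?k = 0"
    using \<open>\<not> N \<le> ?k\<close> by (simp add: fps_X_power_mult_nth)
  then have "?S = 0"
    by (simp add: weighted_curve_nth embE_eq_0_iff)
  then have "lookup ?S \<alpha> = 0"
    by simp
  also have "lookup ?S \<alpha> = (\<Sum>\<beta>\<in>{\<beta>\<in>keys g. wdeg w \<beta> = ?k}. if \<beta> = \<alpha> then lookup g \<alpha> else 0)"
    unfolding lookup_sum by (rule sum.cong) (auto simp: lookup_single when_def)
  also have "\<dots> = lookup g \<alpha>"
    using assms(2) by (simp add: sum.delta)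
  finally show False
    using assms(2) by (simp add: in_keys_iff)
qed

text \<open>Among the curves through p is the generic line p + t x, along which f becomes its
  translate evaluated at t x, so that the power of t reads off total degrees. For negative \<nu>
  both sides are void, since \<open>nat \<nu>\<close> is 0.\<close>

lemma ord_geI:
  assumes "\<And>x. (\<And>i. x i $ 0 = embE (Cst (p i))) \<Longrightarrow> fps_X ^ nat \<nu> dvd peval cst f x"
  shows "ord_ge f p \<nu>"
  unfolding ord_ge_def
proof
  fix \<beta> assume "\<beta> \<in> keys (translate f p)"
  have "fps_X ^ nat \<nu> dvd peval cst f (\<lambda>i. cst (p i) + fps_X ^ 1 * fps_const (embE (Xv i)))"
    by (rule assms) (simp add: cst_nth_0)
  also have "peval cst f (\<lambda>i. cst (p i) + fps_X ^ 1 * fps_const (embE (Xv i))) =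
      peval cst (translate f p) (\<lambda>i. fps_X ^ 1 * fps_const (embE (Xv i)))"
    by (simp add: translate_eq_peval peval_peval is_hom_cst peval_add peval_Cst peval_Xv)
  finally have "nat \<nu> \<le> wdeg (\<lambda>_. 1) \<beta>"
    using \<open>\<beta> \<in> keys (translate f p)\<close> by (rule weighted_curve_dvd)
  then show "\<nu> \<le> int (tdeg \<beta>)"
    by (simp add: wdeg_1[simplified])
qed

lemma fps_X_dvd_decomp:
  fixes x :: "'a::comm_ring_1 fps"
  assumes "x $ 0 = 0" shows "x = fps_X * fps_shift 1 x"
  using assms by (auto simp: fps_eq_iff)

text \<open>Dividing the curve by \<open>l\<close> makes it start at p itself, at the cost of a
  power of \<open>l\<close> because f is homogeneous. Then f becomes its translate evaluated at t
  times a curve, and each of its monomials has degree at least \<nu>. The scalar \<open>l\<close>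
  may be any nonzero element of the field of curve coefficients, and only the coordinates in
  \<open>A\<close> are controlled.\<close>

lemma ord_ge_curve:
  assumes "homog f d" "ord_ge f p \<nu>" "l \<noteq> 0"
    and vars: "\<And>\<alpha>. \<alpha> \<in> keys f \<Longrightarrow> keys \<alpha> \<subseteq> A"
    and x: "\<And>i. i \<in> A \<Longrightarrow> x i $ 0 = l * embE (Cst (p i))"
  shows "fps_X ^ nat \<nu> dvd peval cst f x"
proof -
  \<comment> \<open>The direction of the rescaled curve: \<open>x / l - p\<close> has zero constant
    term, and one factor t is removed.\<close>
  define w where "w i = fps_shift 1 (fps_const (inverse l) * x i - cst (p i))" for i
  have dec: "x i = fps_const l * (cst (p i) + fps_X * w i)" if "i \<in> A" for i
  proof -
    have "fps_const (inverse l) * x i - cst (p i) = fps_X * w i"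
      unfolding w_def by (rule fps_X_dvd_decomp) (use x[OF that] \<open>l \<noteq> 0\<close> in \<open>simp add: cst_nth_0\<close>)
    then have "cst (p i) + fps_X * w i = fps_const (inverse l) * x i"
      by (simp add: algebra_simps)
    then show ?thesis
      using \<open>l \<noteq> 0\<close> by (simp add: mult.assoc[symmetric])
  qed
  have "peval cst f x = peval cst f (\<lambda>i. fps_const l * (cst (p i) + fps_X * w i))"
    by (rule peval_cong) (use dec vars in blast)
  also have "\<dots> = fps_const l ^ nat d * peval cst (translate f p) (\<lambda>i. fps_X * w i)"
    by (simp add: peval_scale[OF assms(1)] translate_eq_peval peval_peval is_hom_cst peval_add peval_Cst peval_Xv)
  also have "fps_X ^ nat \<nu> dvd \<dots>"
  proof (rule dvd_mult, unfold peval_def, rule dvd_sum)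
    fix \<beta> assume "\<beta> \<in> keys (translate f p)"
    then have "nat \<nu> \<le> tdeg \<beta>"
      using assms(2) by (auto simp: ord_ge_def)
    then have "(fps_X :: bigfld fps) ^ nat \<nu> dvd fps_X ^ tdeg \<beta>"
      by (rule le_imp_power_dvd)
    then show "fps_X ^ nat \<nu> dvd cst (lookup (translate f p) \<beta>) * mono_eval (\<lambda>i. fps_X * w i) \<beta>"
      by (simp add: mono_eval_mult mono_eval_const dvd_mult dvd_mult2)
  qed
  finally show ?thesis .
qed

text \<open>In the affine chart at the j-th coordinate point a monomial of degree d has local degree
  d minus its exponent at j. In terms of curves, this is the weight that omits j.\<close>

lemma ord_ge_coordinate_point:
  assumes "homog f d" "\<And>i. p i = (if i = j then 1 else 0)"
  shows "ord_ge f p \<nu> \<longleftrightarrow> (\<forall>\<alpha>\<in>keys f. \<nu> \<le> d - int (lookup \<alpha> j))"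
proof (intro iffI ballI)
  fix \<alpha> assume "ord_ge f p \<nu>" and a: "\<alpha> \<in> keys f"
  let ?w = "\<lambda>i. if i = j then 0 else 1 :: nat"
  have "Xv j \<noteq> 0"
    by (metis Xv_def lookup_single_eq lookup_zero zero_neq_one)
  \<comment> \<open>At t = 0 this curve is \<open>Xv j\<close> times the j-th coordinate vector, so
    the scalar \<open>l\<close> has to be the indeterminate \<open>Xv j\<close>.\<close>
  then have "fps_X ^ nat \<nu> dvd peval cst f (\<lambda>i. fps_X ^ ?w i * fps_const (embE (Xv i)))"
    using is_homD[OF is_hom_embE] is_homD[OF is_hom_Cst] assms(2)
    by (intro ord_ge_curve[OF assms(1) \<open>ord_ge f p \<nu>\<close>, where l = "embE (Xv j)" and A = UNIV])
       (auto simp: embE_eq_0_iff)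
  then have "nat \<nu> \<le> wdeg ?w \<alpha>"
    using a by (rule weighted_curve_dvd)
  moreover have "wdeg ?w \<alpha> + lookup \<alpha> j = tdeg \<alpha>"
    by (rule wdeg_omit)
  moreover have "int (tdeg \<alpha>) = d"
    using assms(1) a by (simp add: homog_def)
  ultimately show "\<nu> \<le> d - int (lookup \<alpha> j)"
    by linarith
next
  assume *: "\<forall>\<alpha>\<in>keys f. \<nu> \<le> d - int (lookup \<alpha> j)"
  let ?w = "\<lambda>i. if i = j then 0 else 1 :: nat"
  show "ord_ge f p \<nu>"
  proof (rule ord_geI)
    fix x assume x: "\<And>i. x i $ 0 = embE (Cst (p i))"
    \<comment> \<open>A curve through the j-th coordinate point has all its other coordinates
      divisible by t; \<open>y\<close> removes that factor.\<close>
    define y where "y i = (if i = j then x i else fps_shift 1 (x i))" for i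
    have "x i $ 0 = 0" if "i \<noteq> j" for i
      using x[of i] that assms(2)[of i] by (simp add: is_homD[OF is_hom_embE] is_homD[OF is_hom_Cst])
    then have "x = (\<lambda>i. fps_X ^ ?w i * y i)"
      by (auto simp: fun_eq_iff y_def intro: fps_X_dvd_decomp[simplified])
    then have me: "mono_eval x \<alpha> = fps_X ^ wdeg ?w \<alpha> * mono_eval y \<alpha>" for \<alpha>
      by (simp only: mono_eval_mult mono_eval_weights)
    show "fps_X ^ nat \<nu> dvd peval cst f x"
      unfolding peval_def
    proof (rule dvd_sum)
      fix \<alpha> assume a: "\<alpha> \<in> keys f"
      have "int (tdeg \<alpha>) = d"
        using assms(1) a by (simp add: homog_def)
      then have "nat \<nu> \<le> wdeg ?w \<alpha>"
        using * a wdeg_omit[of j \<alpha>] by force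
      then have "(fps_X :: bigfld fps) ^ nat \<nu> dvd fps_X ^ wdeg ?w \<alpha>"
        by (rule le_imp_power_dvd)
      then show "fps_X ^ nat \<nu> dvd cst (lookup f \<alpha>) * mono_eval x \<alpha>"
        by (simp only: me dvd_mult dvd_mult2)
    qed
  qed
qed

section \<open>Generic configurations have nonvanishing orbits\<close>

definition cemb :: "complex \<Rightarrow> fld" where "cemb c = Fract (single 0 c) 1"

lemma is_hom_Fract: "is_hom (\<lambda>p::cpoly. Fract p 1)"
  by (auto simp: is_hom_def Zero_fract_def One_fract_def)

lemma is_hom_cemb: "is_hom cemb"
  using is_hom_comp[OF is_hom_Fract is_hom_single0] by (simp add: cemb_def[abs_def])

lemma peval_var: "peval cemb q var = Fract q 1"
proof (induction q rule: poly_add_induct)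
  case (single \<alpha> c)
  have "mono_eval var \<alpha> = Fract (single \<alpha> 1) 1"
    using mono_eval_hom[OF is_hom_Fract, of "\<lambda>i. single (single i 1) 1" \<alpha>]
    by (simp add: mono_eval_vars[simplified] var_def[abs_def])
  then have "peval cemb (single \<alpha> c) var = cemb c * Fract (single \<alpha> 1) 1"
    by (simp add: peval_single is_homD[OF is_hom_cemb])
  also have "cemb c * Fract (single \<alpha> 1) 1 = Fract (single \<alpha> c) 1"
    by (simp add: cemb_def mult_single)
  finally show ?case .
qed (simp_all add: peval_add is_hom_cemb Zero_fract_def)

text \<open>\<open>evaluates v x y\<close>: the rational function \<open>x\<close> is regular at the point \<open>v\<close>, with value \<open>y\<close>.\<close>
definition evaluates :: "(nat \<Rightarrow> fld) \<Rightarrow> fld \<Rightarrow> fld \<Rightarrow> bool" where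
  "evaluates v x y \<longleftrightarrow>
     (\<exists>p q. x = Fract p q \<and> peval cemb q v \<noteq> 0 \<and> y = peval cemb p v / peval cemb q v)"

lemma evaluatesI: "peval cemb q v \<noteq> 0 \<Longrightarrow> evaluates v (Fract p q) (peval cemb p v / peval cemb q v)"
  unfolding evaluates_def by blast

text \<open>Two representations of a fraction give a polynomial identity by cross-multiplication,
  and this identity can be evaluated at v because neither denominator vanishes there.\<close>

lemma evaluates_unique:
  assumes "evaluates v x y" "evaluates v x y'" shows "y = y'"
proof -
  obtain p q where pq: "x = Fract p q" "peval cemb q v \<noteq> 0" "y = peval cemb p v / peval cemb q v"
    using assms(1) unfolding evaluates_def by blast
  obtain r s where rs: "x = Fract r s" "peval cemb s v \<noteq> 0" "y' = peval cemb r v / peval cemb s v"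
    using assms(2) unfolding evaluates_def by blast
  have "q \<noteq> 0" "s \<noteq> 0" using pq rs by auto
  then have "p * s = r * q"
    using pq(1) rs(1) by (simp add: eq_fract)
  then have "peval cemb (p * s) v = peval cemb (r * q) v"
    by simp
  then have "peval cemb p v * peval cemb s v = peval cemb r v * peval cemb q v"
    by (simp add: peval_mult is_hom_cemb)
  then show ?thesis
    using pq rs by (simp add: frac_eq_eq)
qed

lemma evaluates_add:
  assumes "evaluates v x y" "evaluates v x' y'" shows "evaluates v (x + x') (y + y')"
proof -
  obtain p q where pq: "x = Fract p q" "peval cemb q v \<noteq> 0" "y = peval cemb p v / peval cemb q v"
    using assms(1) unfolding evaluates_def by blast
  obtain r s where rs: "x' = Fract r s" "peval cemb s v \<noteq> 0" "y' = peval cemb r v / peval cemb s v"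
    using assms(2) unfolding evaluates_def by blast
  have "q \<noteq> 0" "s \<noteq> 0" using pq rs by auto
  then show ?thesis
    using evaluatesI[of "q * s" v "p * s + r * q"] pq rs
    by (simp add: peval_mult peval_add is_hom_cemb add_frac_eq)
qed

lemma evaluates_mult:
  assumes "evaluates v x y" "evaluates v x' y'" shows "evaluates v (x * x') (y * y')"
proof -
  obtain p q where pq: "x = Fract p q" "peval cemb q v \<noteq> 0" "y = peval cemb p v / peval cemb q v"
    using assms(1) unfolding evaluates_def by blast
  obtain r s where rs: "x' = Fract r s" "peval cemb s v \<noteq> 0" "y' = peval cemb r v / peval cemb s v"
    using assms(2) unfolding evaluates_def by blast
  show ?thesis
    using evaluatesI[of "q * s" v "p * r"] pq rs
    by (simp add: peval_mult is_hom_cemb)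
qed

lemma evaluates_inverse:
  assumes "evaluates v x y" "y \<noteq> 0" shows "evaluates v (inverse x) (inverse y)"
proof -
  obtain p q where pq: "x = Fract p q" "peval cemb q v \<noteq> 0" "y = peval cemb p v / peval cemb q v"
    using assms(1) unfolding evaluates_def by blast
  show ?thesis
    using evaluatesI[of p v q] pq assms(2) by simp
qed

lemma evaluates_divide:
  "evaluates v x y \<Longrightarrow> evaluates v x' y' \<Longrightarrow> y' \<noteq> 0 \<Longrightarrow> evaluates v (x / x') (y / y')"
  by (simp add: divide_inverse evaluates_mult evaluates_inverse)

lemma evaluates_cemb: "evaluates v (cemb c) (cemb c)"
  using evaluatesI[of 1 v "single 0 c"]
  by (simp add: cemb_def[of c, symmetric] peval_1 is_hom_cemb peval_single is_homD[OF is_hom_cemb])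

lemma evaluates_0: "evaluates v 0 0" and evaluates_1: "evaluates v 1 1"
  using evaluates_cemb[of v 0] evaluates_cemb[of v 1] by (simp_all add: is_homD[OF is_hom_cemb])

lemma evaluates_diff:
  assumes "evaluates v x y" "evaluates v x' y'" shows "evaluates v (x - x') (y - y')"
proof -
  have "cemb (-1) = -1"
    by (simp add: is_hom_minus[OF is_hom_cemb] is_homD[OF is_hom_cemb])
  then show ?thesis
    using evaluates_add[OF assms(1) evaluates_mult[OF evaluates_cemb[of v "-1"] assms(2)]] by simp
qed

lemma evaluates_var: "evaluates v (var i) (v i)"
  using evaluatesI[of 1 v "single (single i 1) 1"]
  by (simp add: var_def peval_1 is_hom_cemb peval_single is_homD[OF is_hom_cemb])

lemma evaluates_sum: "(\<And>a. a \<in> A \<Longrightarrow> evaluates v (f a) (g a)) \<Longrightarrow> evaluates v (sum f A) (sum g A)"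
  by (induction A rule: infinite_finite_induct) (auto simp: evaluates_0 evaluates_add)

lemma evaluates_prod: "(\<And>a. a \<in> A \<Longrightarrow> evaluates v (f a) (g a)) \<Longrightarrow> evaluates v (prod f A) (prod g A)"
  by (induction A rule: infinite_finite_induct) (auto simp: evaluates_1 evaluates_mult)

lemma evaluates_power: "evaluates v x y \<Longrightarrow> evaluates v (x ^ k) (y ^ k)"
  by (induction k) (auto simp: evaluates_1 evaluates_mult)

lemma evaluates_peval:
  "(\<And>i. evaluates v (s i) (t i)) \<Longrightarrow> evaluates v (peval cemb q s) (peval cemb q t)"
  unfolding peval_def mono_eval_def
  by (intro evaluates_sum evaluates_mult evaluates_cemb evaluates_prod evaluates_power)

text \<open>The assumption says that \<open>s\<close> is a rational involution: if \<open>q\<close> vanished at \<open>s\<close>, then evaluating the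
  zero function \<open>q \<circ> s\<close> at the point \<open>s\<close> would give back \<open>q = 0\<close>.\<close>
lemma involution_peval_neq_0:
  assumes "\<And>i. evaluates s (s i) (var i)" "q \<noteq> 0"
  shows "peval cemb q s \<noteq> 0"
proof
  assume "peval cemb q s = 0"
  then have "evaluates s 0 (Fract q 1)"
    using evaluates_peval[of s s var q] assms(1) by (simp add: peval_var)
  then have "Fract q 1 = 0"
    using evaluates_0 evaluates_unique by blast
  then show False
    using assms(2) by (simp add: Zero_fract_def eq_fract)
qed

section \<open>Substitution endomorphisms of the function field\<close>

definition subst_hom :: "(nat \<Rightarrow> fld) \<Rightarrow> fld \<Rightarrow> fld" where
  "subst_hom s x = (THE y. evaluates s x y)"

lemma subst_hom_eq: "evaluates s x y \<Longrightarrow> subst_hom s x = y"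
  unfolding subst_hom_def using evaluates_unique by blast

text \<open>For an involution no denominator vanishes at s, so every fraction has a value there. The
  homomorphism laws are then those of \<open>evaluates\<close>.\<close>

lemma is_hom_subst_hom:
  assumes "\<And>i. evaluates s (s i) (var i)"
  shows "is_hom (subst_hom s)"
proof -
  have ev: "evaluates s x (subst_hom s x)" for x
  proof -
    obtain p q where "x = Fract p q" "q \<noteq> 0"
      by (cases x)
    then have "evaluates s x (peval cemb p s / peval cemb q s)"
      using evaluatesI involution_peval_neq_0[OF assms] by blast
    then show ?thesis
      using subst_hom_eq by simp
  qed
  show ?thesis
    unfolding is_hom_def
    by (intro conjI allI subst_hom_eq evaluates_0 evaluates_1 evaluates_add evaluates_mult ev)
qed

section \<open>Field homomorphisms and the action of words on configurations\<close>

lemma field_hom_inverse: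
  fixes h :: "'a::field \<Rightarrow> 'b::field"
  assumes "is_hom h" shows "h (inverse x) = inverse (h x)"
proof (cases "x = 0")
  case False
  then have "h x * h (inverse x) = 1"
    using is_homD(4)[OF assms, of x "inverse x"] is_homD(2)[OF assms] by simp
  then show ?thesis
    by (simp add: inverse_unique)
qed (use is_homD[OF assms] in auto)

lemma field_hom_divide:
  fixes h :: "'a::field \<Rightarrow> 'b::field"
  shows "is_hom h \<Longrightarrow> h (x / y) = h x / h y"
  by (simp add: divide_inverse is_homD field_hom_inverse)

lemma field_hom_neq_0:
  fixes h :: "'a::field \<Rightarrow> 'b::field"
  assumes "is_hom h" "x \<noteq> 0" shows "h x \<noteq> 0"
proof
  assume "h x = 0"
  then have "h (x * inverse x) = 0"
    by (simp only: is_homD(4)[OF assms(1)]) simp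
  then show False
    using assms by (simp add: is_homD(2))
qed

text \<open>All generators are given by field operations and the constant 1 only, so they commute
  with every field homomorphism.\<close>

lemma cfg_step_hom:
  "is_hom h \<Longrightarrow> cfg_step m k (\<lambda>j i. h (C j i)) = (\<lambda>j i. h (cfg_step m k C j i))"
  by (auto simp: cfg_step_def fun_eq_iff field_hom_inverse field_hom_divide is_hom_diff is_homD)

lemma cfg_act_hom:
  "is_hom h \<Longrightarrow> cfg_act m w (\<lambda>j i. h (C j i)) = (\<lambda>j i. h (cfg_act m w C j i))"
  by (induction w arbitrary: C) (simp_all add: cfg_step_hom)

text \<open>Row 0 is left out on purpose: \<open>U i 0\<close> and \<open>Z i\<close> are the same
  variable, so row 0 of the generic configuration repeats row \<open>n + 1\<close> and need not
  follow the substitution below. No step for a row from 1 on reads row 0.\<close>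

lemma cfg_step_cong:
  assumes "\<And>j. 1 \<le> j \<Longrightarrow> C j = C' j" "1 \<le> j"
  shows "cfg_step m k C j = cfg_step m k C' j"
proof -
  note C = assms(1)[OF \<open>1 \<le> j\<close>] assms(1)[of "m + 2"] assms(1)[of k] assms(1)[of "k + 1"]
  show ?thesis
    using C by (simp add: cfg_step_def fun_eq_iff)
qed

lemma cfg_act_cong:
  "(\<And>j. 1 \<le> j \<Longrightarrow> C j = C' j) \<Longrightarrow> 1 \<le> j \<Longrightarrow> cfg_act m w C j = cfg_act m w C' j"
proof (induction w arbitrary: C C')
  case Nil
  then show ?case
    by (metis cfg_act.simps(1))
next
  case (Cons k w)
  have "cfg_act m w (cfg_step m k C) j = cfg_act m w (cfg_step m k C') j"
  proof (rule Cons.IH)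
    show "cfg_step m k C j' = cfg_step m k C' j'" if "1 \<le> j'" for j'
      using cfg_step_cong[of C C' j'] Cons.prems(1) that by blast
  qed (rule Cons.prems(2))
  then show ?case
    by simp
qed

text \<open>With 1 < m the index m - 1 is nonzero, so the branches of the definition are disjoint
  and each can be used on its own.\<close>

lemma cfg_step_simps:
  assumes "1 < m"
  shows "cfg_step m 0 C = (\<lambda>j i. inverse (C j i))"
    and "0 < k \<Longrightarrow> k < m - 1 \<Longrightarrow>
      cfg_step m k C = (\<lambda>j i. if i = k then C j (k + 1) else if i = k + 1 then C j k else C j i)"
    and "cfg_step m (m - 1) C =
      (\<lambda>j i. if i = m - 1 then inverse (C j (m - 1)) else C j i / C j (m - 1))"
    and "cfg_step m m C = (\<lambda>j i. 1 - C j i)"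
    and "cfg_step m (m + 1) C =
      (\<lambda>j i. if j = m + 2 then inverse (C (m + 2) i) else C j i / C (m + 2) i)"
    and "m + 2 \<le> k \<Longrightarrow>
      cfg_step m k C = (\<lambda>j i. if j = k then C (k + 1) i else if j = k + 1 then C k i else C j i)"
proof -
  obtain l where "m = Suc (Suc l)"
    using assms that[of "m - 2"] by simp
  then show "cfg_step m 0 C = (\<lambda>j i. inverse (C j i))"
    and "0 < k \<Longrightarrow> k < m - 1 \<Longrightarrow>
      cfg_step m k C = (\<lambda>j i. if i = k then C j (k + 1) else if i = k + 1 then C j k else C j i)"
    and "cfg_step m (m - 1) C =
      (\<lambda>j i. if i = m - 1 then inverse (C j (m - 1)) else C j i / C j (m - 1))"
    and "cfg_step m m C = (\<lambda>j i. 1 - C j i)"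
    and "cfg_step m (m + 1) C =
      (\<lambda>j i. if j = m + 2 then inverse (C (m + 2) i) else C j i / C (m + 2) i)"
    and "m + 2 \<le> k \<Longrightarrow>
      cfg_step m k C = (\<lambda>j i. if j = k then C (k + 1) i else if j = k + 1 then C k i else C j i)"
    by (auto simp: cfg_step_def fun_eq_iff)
qed

lemma generator_cases:
  fixes k m :: nat
  obtains "k = 0" | "0 < k" "k < m - 1" | "k = m - 1" "0 < k" | "k = m" | "k = m + 1" | "m + 2 \<le> k"
  by linarith

text \<open>The generator \<open>k = m\<close> replaces each entry by 1 minus that entry. It divides
  by nothing, and it may turn nonzero entries into zero. Nonvanishing is therefore asked for the
  other generators only, which invert, divide or permute entries.\<close>

lemma evaluates_cfg_step:
  assumes "\<And>j i. 1 \<le> j \<Longrightarrow> evaluates v (A j i) (B j i)"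
    and "\<And>j i. k \<noteq> m \<Longrightarrow> 1 \<le> j \<Longrightarrow> B j i \<noteq> 0" and "1 \<le> j" "1 < m"
  shows "evaluates v (cfg_step m k A j i) (cfg_step m k B j i)"
proof (cases rule: generator_cases[where k = k and m = m])
  case 4
  then show ?thesis
    using assms by (simp add: cfg_step_simps evaluates_diff evaluates_1)
next
  case 6
  then show ?thesis
    using assms by (simp add: cfg_step_simps)
qed (use assms in \<open>simp_all add: cfg_step_simps evaluates_inverse evaluates_divide
        del: One_nat_def add_2_eq_Suc add_2_eq_Suc'\<close>)

lemma cfg_step_involution:
  assumes "\<And>j i. k \<noteq> m \<Longrightarrow> 1 \<le> j \<Longrightarrow> C j i \<noteq> 0" "1 \<le> j" "1 < m"
  shows "cfg_step m k (cfg_step m k C) j i = C j i"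
  by (cases rule: generator_cases[where k = k and m = m])
    (use assms in \<open>simp_all add: cfg_step_simps del: One_nat_def add_2_eq_Suc add_2_eq_Suc'\<close>)

lemma cfg_step_neq_0:
  assumes "\<And>j i. 1 \<le> j \<Longrightarrow> C j i \<noteq> 0" "1 \<le> j" "k \<noteq> m" "1 < m"
  shows "cfg_step m k C j i \<noteq> 0"
  by (cases rule: generator_cases[where k = k and m = m])
    (use assms in \<open>simp_all add: cfg_step_simps del: One_nat_def add_2_eq_Suc add_2_eq_Suc'\<close>)

lemma cfg_act_gen_cfg_neq_0:
  assumes "1 < m" "1 \<le> j"
  shows "cfg_act m w (gen_cfg n) j i \<noteq> 0"
proof (induction w)
  case Nil
  then show ?case
    using var_neq_0 by (auto simp: gen_cfg_def U_def Z_def)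
next
  case (Cons k w)
  let ?g = "gen_cfg n"
  have g_neq_0: "?g j i \<noteq> 0" for j i
    using var_neq_0 by (auto simp: gen_cfg_def U_def Z_def)
  txt \<open>\<^const>\<open>gen_cfg\<close> uses the variables with index \<open>(i, 0)\<close> for row \<open>n + 1\<close> and never those with index \<open>(i, n + 1)\<close>.\<close>
  define s where "s l = (case prod_decode l of (i, j) \<Rightarrow>
      if j = 0 then cfg_step m k ?g (n + 1) i else if j = n + 1 then var l
      else cfg_step m k ?g j i)" for l
  have ev_g: "evaluates s (?g j i) (cfg_step m k ?g j i)" if "1 \<le> j" for j i
    using evaluates_var[of s "prod_encode (i, if j = n + 1 then 0 else j)"] that
    by (auto simp: gen_cfg_def U_def Z_def s_def split: if_splits)
  have ev_s: "evaluates s (cfg_step m k ?g j i) (?g j i)" if "1 \<le> j" for j i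
  proof -
    have "evaluates s (cfg_step m k ?g j i) (cfg_step m k (cfg_step m k ?g) j i)"
      \<comment> \<open>Substituting into the stepped configuration steps it a second time, which by
        involutivity gives back the generic one.\<close>
      using ev_g cfg_step_neq_0[OF g_neq_0] that assms(1) by (intro evaluates_cfg_step)
    then show ?thesis
      using g_neq_0 that assms(1) by (simp add: cfg_step_involution)
  qed
  have inv: "evaluates s (s l) (var l)" for l
  proof -
    obtain i j where ij: "prod_decode l = (i, j)"
      by (cases "prod_decode l")
    then have l: "l = prod_encode (i, j)"
      by (metis prod_decode_inverse)
    consider "j = 0" | "j = n + 1" | "1 \<le> j" "j \<noteq> n + 1"
      by linarith
    then show ?thesis
    proof cases
      case 1
      then show ?thesis
        using ev_s[of "n + 1" i] by (simp add: s_def l gen_cfg_def Z_def)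
    next
      case 2
      then have "s l = var l"
        by (simp add: s_def l)
      then show ?thesis
        using evaluates_var[of s l] by simp
    next
      case 3
      then show ?thesis
        using ev_s[of j i] by (simp add: s_def l gen_cfg_def U_def)
    qed
  qed
  let ?h = "subst_hom s"
  \<comment> \<open>The first letter is traded for the endomorphism \<open>?h\<close>, which is then
    pulled out of the action of the remaining word.\<close>
  have "cfg_act m (k # w) ?g j i = cfg_act m w (\<lambda>j i. ?h (?g j i)) j i"
    using cfg_act_cong[of "cfg_step m k ?g" "\<lambda>j i. ?h (?g j i)"] subst_hom_eq[OF ev_g] assms(2)
    by (simp add: fun_eq_iff)
  also have "\<dots> = ?h (cfg_act m w ?g j i)"
    by (simp add: cfg_act_hom is_hom_subst_hom[OF inv])
  finally show ?case
    using field_hom_neq_0[OF is_hom_subst_hom[OF inv] Cons.IH] by simp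
qed

section \<open>Spaces of polynomials vanishing along a point configuration\<close>

definition Lpts :: "nat \<Rightarrow> nat \<Rightarrow> (nat \<Rightarrow> nat \<Rightarrow> fld) \<Rightarrow> (nat \<Rightarrow> int) \<Rightarrow> xpoly set" where
  "Lpts m n P \<Lambda> = {f. Kpoly m n f \<and> homog f (\<Lambda> 0) \<and> (\<forall>j\<in>{1..n}. ord_ge f (P j) (- \<Lambda> j))}"

lemma Lsp_eq_Lpts: "Lsp m n a = Lpts m n (pt m a)"
  by (simp add: Lsp_def Lpts_def fun_eq_iff)

text \<open>Dimension one phrased through a generator, a form that is carried along directly by
  bijections commuting with scalars.\<close>

definition one_dim :: "nat \<Rightarrow> nat \<Rightarrow> xpoly set \<Rightarrow> bool" where
  "one_dim m n S \<longleftrightarrow> (\<exists>f\<in>S. f \<noteq> 0 \<and> (\<forall>g\<in>S. \<exists>c\<in>Kfield m n. g = Cst c * f))"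

lemma one_dim_imp_has_Kdim:
  assumes "one_dim m n S"
  shows "has_Kdim m n S 1"
proof -
  obtain f where f: "f \<in> S" "f \<noteq> 0" "\<And>g. g \<in> S \<Longrightarrow> \<exists>c\<in>Kfield m n. g = Cst c * f"
    using assms unfolding one_dim_def by blast
  have "Kindep m n {f}"
    using f(2) by (auto simp: Kindep_def smult_x_def Cst_eq_0_iff)
  moreover have "S \<subseteq> Kspan m n {f}"
  proof
    fix g assume "g \<in> S"
    then obtain c where "c \<in> Kfield m n" "g = Cst c * f"
      using f(3) by blast
    then show "g \<in> Kspan m n {f}"
      by (auto simp: Kspan_def smult_x_def intro!: exI[of _ "\<lambda>_. c"])
  qed
  ultimately show ?thesis
    unfolding has_Kdim_def using f(1) by (intro exI[of _ "{f}"]) auto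
qed

lemma one_dim_transfer:
  assumes "one_dim m n S'"
    and "\<And>f. f \<in> S' \<Longrightarrow> T f \<in> S" "\<And>f. f \<in> S \<Longrightarrow> T' f \<in> S'"
    and "\<And>f. f \<in> S \<Longrightarrow> T (T' f) = f" "\<And>f. f \<in> S' \<Longrightarrow> T' (T f) = f"
    and "\<And>c f. c \<in> Kfield m n \<Longrightarrow> f \<in> S' \<Longrightarrow> T (Cst c * f) = Cst c * T f" "T' 0 = 0"
  shows "one_dim m n S"
proof -
  obtain f where f: "f \<in> S'" "f \<noteq> 0" "\<And>g. g \<in> S' \<Longrightarrow> \<exists>c\<in>Kfield m n. g = Cst c * f"
    using assms(1) unfolding one_dim_def by blast
  have "\<exists>c\<in>Kfield m n. g = Cst c * T f" if g: "g \<in> S" for g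
    using f(3)[OF assms(3)[OF g]] assms(4)[OF g] assms(6) f(1) by metis
  moreover have "T f \<noteq> 0"
    using assms(5)[OF f(1)] assms(7) f(2) by auto
  ultimately show ?thesis
    unfolding one_dim_def using assms(2)[OF f(1)] by blast
qed

text \<open>\<open>s\<close> is the lattice map accompanying a change of configuration from \<open>(P, q)\<close> to \<open>(P', q')\<close>.
  The factor \<open>u\<close> has to be a homomorphism in \<open>\<Lambda>\<close>: this is what makes the ratios \<open>u (w s\<^sub>0 e\<^sub>i) / u (w e\<^sub>i)\<close>
  independent of \<open>i\<close>.\<close>
definition Lstep :: "nat \<Rightarrow> nat \<Rightarrow> (nat \<Rightarrow> nat \<Rightarrow> fld) \<Rightarrow> (nat \<Rightarrow> fld) \<Rightarrow> (nat \<Rightarrow> nat \<Rightarrow> fld) \<Rightarrow> (nat \<Rightarrow> fld)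
    \<Rightarrow> ((nat \<Rightarrow> int) \<Rightarrow> nat \<Rightarrow> int) \<Rightarrow> bool" where
  "Lstep m n P q P' q' s \<longleftrightarrow> (\<exists>u :: (nat \<Rightarrow> int) \<Rightarrow> fld. (\<forall>\<Lambda>. u \<Lambda> \<noteq> 0) \<and>
     (\<forall>\<Lambda> H. u (\<lambda>i. \<Lambda> i + H i) = u \<Lambda> * u H) \<and>
     (\<forall>\<Lambda>. one_dim m n (Lpts m n P' \<Lambda>) \<longrightarrow> one_dim m n (Lpts m n P (s \<Lambda>)) \<and>
        (\<forall>f\<in>Lpts m n P (s \<Lambda>). f \<noteq> 0 \<longrightarrow>
           (\<exists>f'\<in>Lpts m n P' \<Lambda>. f' \<noteq> 0 \<and> eval_x f q = u \<Lambda> * eval_x f' q'))))"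

lemma Kpoly_keys: "Kpoly m n f \<Longrightarrow> \<alpha> \<in> keys f \<Longrightarrow> keys \<alpha> \<subseteq> {1..m}"
  by (auto simp: Kpoly_def)

lemma peval_cong_Kpoly:
  assumes "Kpoly m n f" "\<And>i. i \<in> {1..m} \<Longrightarrow> x i = y i"
  shows "peval h f x = peval h f y"
  by (rule peval_cong) (use Kpoly_keys[OF assms(1)] assms(2) in blast)

lemma is_hom_fps_nth_0: "is_hom (\<lambda>F :: 'a::comm_ring_1 fps. F $ 0)"
  by (auto simp: is_hom_def)

lemma peval_cst_nth_0:
  assumes "\<And>i. x i $ 0 = embE (Cst (p i))"
  shows "peval cst f x $ 0 = embE (Cst (eval_x f p))"
proof -
  have "peval cst f x $ 0 = peval (\<lambda>c. embE (Cst c)) f (\<lambda>i. embE (Cst (p i)))"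
    using peval_hom[OF is_hom_fps_nth_0, of cst f x] assms by (simp add: cst_nth_0)
  also have "\<dots> = embE (Cst (eval_x f p))"
    using peval_hom[OF is_hom_comp[OF is_hom_embE is_hom_Cst], of "\<lambda>c. c" f p]
    by (simp add: eval_x_eq_peval)
  finally show ?thesis .
qed

section \<open>Linear changes of coordinates\<close>

text \<open>The map g takes a curve starting at p to a curve starting at a multiple of p', along
  which the order of f is known.\<close>

lemma ord_ge_linear_subst:
  assumes "Kpoly m n f" "homog f d" "l \<noteq> 0"
    and "\<And>i. i \<in> {1..m} \<Longrightarrow> eval_x (g i) p = l * p' i"
    and "ord_ge f p' \<nu>"
  shows "ord_ge (peval Cst f g) p \<nu>"
proof (rule ord_geI)
  fix x assume "\<And>i. x i $ 0 = embE (Cst (p i))"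
  then have "peval cst (g i) x $ 0 = embE (Cst l) * embE (Cst (p' i))" if "i \<in> {1..m}" for i
    using assms(4)[OF that] peval_cst_nth_0[of x p "g i"]
    by (simp add: is_homD[OF is_hom_embE] is_homD[OF is_hom_Cst])
  then show "fps_X ^ nat \<nu> dvd peval cst (peval Cst f g) x"
    unfolding peval_peval[OF is_hom_cst]
    by (intro ord_ge_curve[OF assms(2,5), where l = "embE (Cst l)" and A = "{1..m}"])
      (use Kpoly_keys[OF assms(1)] \<open>l \<noteq> 0\<close> in \<open>auto simp: embE_eq_0_iff Cst_eq_0_iff\<close>)
qed

lemma homog_neq_0_imp_nonneg:
  assumes "homog f d" "f \<noteq> 0" shows "0 \<le> d"
proof -
  obtain \<alpha> where "\<alpha> \<in> keys f"
    using assms(2) by (metis poly_sum_monomials sum.empty equals0I)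
  then show ?thesis
    using assms(1) by (auto simp: homog_def)
qed

text \<open>The isomorphism is pull-back along g, with pull-back along g' as inverse; \<sigma>
  records which old point g carries to the j-th new one. If g sends q to l q', a form of degree d
  picks up the factor \<open>l^d\<close> at q, and d is additive in \<Lambda>.\<close>

lemma Lstep_linear:
  assumes g: "\<And>i. i \<in> {1..m} \<Longrightarrow> Kpoly m n (g i) \<and> homog (g i) 1"
    and g': "\<And>i. i \<in> {1..m} \<Longrightarrow> Kpoly m n (g' i) \<and> homog (g' i) 1"
    and gg': "\<And>i. i \<in> {1..m} \<Longrightarrow> peval Cst (g i) g' = Xv i"
    and g'g: "\<And>i. i \<in> {1..m} \<Longrightarrow> peval Cst (g' i) g = Xv i"
    and \<sigma>: "\<sigma> ` {1..n} = {1..n}"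
    and P: "\<And>j. j \<in> {1..n} \<Longrightarrow> \<exists>l. l \<noteq> 0 \<and> (\<forall>i\<in>{1..m}. eval_x (g i) (P (\<sigma> j)) = l * P' j i)"
    and q: "\<exists>l. l \<noteq> 0 \<and> (\<forall>i\<in>{1..m}. eval_x (g i) q = l * q' i)"
    and s: "\<And>\<Lambda>. s \<Lambda> 0 = \<Lambda> 0" "\<And>\<Lambda> j. j \<in> {1..n} \<Longrightarrow> s \<Lambda> (\<sigma> j) = \<Lambda> j"
  shows "Lstep m n P q P' q' s"
proof -
  let ?T = "\<lambda>f. peval Cst f g" and ?T' = "\<lambda>f. peval Cst f g'"
  have TT': "?T (?T' f) = f" and T'T: "?T' (?T f) = f" if "Kpoly m n f" for f
  proof -
    have "?T (?T' f) = peval Cst f Xv"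
      unfolding peval_peval[OF is_hom_Cst] by (rule peval_cong_Kpoly[OF that]) (rule g'g)
    then show "?T (?T' f) = f" by (simp add: peval_Cst_Xv)
    have "?T' (?T f) = peval Cst f Xv"
      unfolding peval_peval[OF is_hom_Cst] by (rule peval_cong_Kpoly[OF that]) (rule gg')
    then show "?T' (?T f) = f" by (simp add: peval_Cst_Xv)
  qed
  have homog_T: "homog (?T f) d" if "Kpoly m n f" "homog f d" for f d
    by (rule homog_peval[OF that(2)]) (use g Kpoly_keys[OF that(1)] in blast)
  have homog_T': "homog (?T' f) d" if "Kpoly m n f" "homog f d" for f d
    by (rule homog_peval[OF that(2)]) (use g' Kpoly_keys[OF that(1)] in blast)
  have P_inv: "\<exists>l. l \<noteq> 0 \<and> (\<forall>i\<in>{1..m}. eval_x (g' i) (P' j) = l * P (\<sigma> j) i)" if j: "j \<in> {1..n}" for j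
  proof -
    obtain l where l: "l \<noteq> 0" "\<And>i. i \<in> {1..m} \<Longrightarrow> eval_x (g i) (P (\<sigma> j)) = l * P' j i"
      using P[OF j] by blast
    have "eval_x (g' i) (P' j) = inverse l * P (\<sigma> j) i" if i: "i \<in> {1..m}" for i
    proof -
      have gi: "Kpoly m n (g' i)" "homog (g' i) 1"
        using g'[OF i] by auto
      \<comment> \<open>Applying g' to the relation between g (P (\<sigma> j)) and P' j inverts it:
        g' has degree 1, and composing it with g gives the identity.\<close>
      have "l * eval_x (g' i) (P' j) = eval_x (g' i) (\<lambda>i. l * P' j i)"
        using peval_scale[OF gi(2), of "\<lambda>c. c" l "P' j"] by (simp add: eval_x_eq_peval)
      also have "\<dots> = eval_x (g' i) (\<lambda>i. eval_x (g i) (P (\<sigma> j)))"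
        unfolding eval_x_eq_peval by (rule peval_cong_Kpoly[OF gi(1)]) (simp add: l(2)[symmetric] eval_x_eq_peval)
      also have "\<dots> = eval_x (peval Cst (g' i) g) (P (\<sigma> j))"
        by (simp add: eval_x_eq_peval peval_peval is_hom_id)
      also have "\<dots> = P (\<sigma> j) i"
        by (simp add: g'g[OF i] eval_x_eq_peval peval_Xv is_hom_id)
      finally show ?thesis
        using l(1) by (simp add: field_simps)
    qed
    then show ?thesis
      using l(1) by (intro exI[of _ "inverse l"]) auto
  qed
  have T_mem: "?T f \<in> Lpts m n P (s \<Lambda>)" if f: "f \<in> Lpts m n P' \<Lambda>" for f \<Lambda>
  proof -
    have Kf: "Kpoly m n f" and hf: "homog f (\<Lambda> 0)"
      using f by (auto simp: Lpts_def)
    have "ord_ge (?T f) (P (\<sigma> j)) (- s \<Lambda> (\<sigma> j))" if j: "j \<in> {1..n}" for j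
    proof -
      have "ord_ge f (P' j) (- \<Lambda> j)"
        using f j by (auto simp: Lpts_def)
      then show ?thesis
        using P[OF j] ord_ge_linear_subst[OF Kf hf] s(2)[OF j] by metis
    qed
    then have "ord_ge (?T f) (P j) (- s \<Lambda> j)" if j: "j \<in> {1..n}" for j
      using j \<sigma> by (metis imageE)
    then show ?thesis
      unfolding Lpts_def using Kpoly_peval[OF Kf] homog_T[OF Kf hf] g s(1) by auto
  qed
  have T'_mem: "?T' f \<in> Lpts m n P' \<Lambda>" if f: "f \<in> Lpts m n P (s \<Lambda>)" for f \<Lambda>
  proof -
    have Kf: "Kpoly m n f" and hf: "homog f (\<Lambda> 0)"
      using f s(1) by (auto simp: Lpts_def)
    have "ord_ge (?T' f) (P' j) (- \<Lambda> j)" if j: "j \<in> {1..n}" for j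
    proof -
      have "\<sigma> j \<in> {1..n}"
        using j \<sigma> by blast
      then have "ord_ge f (P (\<sigma> j)) (- s \<Lambda> (\<sigma> j))"
        using f unfolding Lpts_def by blast
      then have "ord_ge f (P (\<sigma> j)) (- \<Lambda> j)"
        by (simp only: s(2)[OF j])
      then show ?thesis
        using P_inv[OF j] ord_ge_linear_subst[OF Kf hf] by metis
    qed
    then show ?thesis
      unfolding Lpts_def using Kpoly_peval[OF Kf] homog_T'[OF Kf hf] g' by auto
  qed
  obtain l where l: "l \<noteq> 0" "\<And>i. i \<in> {1..m} \<Longrightarrow> eval_x (g i) q = l * q' i"
    using q by blast
  have Kp: "Kpoly m n f" if "f \<in> Lpts m n P \<Lambda>" for f P \<Lambda>
    using that by (simp add: Lpts_def)
  show ?thesis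
    unfolding Lstep_def
  \<comment> \<open>Integer powers keep the factor nonzero and multiplicative on the whole lattice.
    Where a nonzero form exists the degree is nonnegative, and the ordinary power results.\<close>
  proof (intro exI[of _ "\<lambda>\<Lambda>. l powi \<Lambda> 0"] conjI allI impI ballI)
    show "l powi \<Lambda> 0 \<noteq> 0" for \<Lambda> :: "nat \<Rightarrow> int"
      using l(1) by simp
    show "l powi (\<Lambda> 0 + H 0) = l powi \<Lambda> 0 * l powi H 0" for \<Lambda> H :: "nat \<Rightarrow> int"
      using l(1) by (simp add: power_int_add)
    fix \<Lambda> assume od: "one_dim m n (Lpts m n P' \<Lambda>)"
    show "one_dim m n (Lpts m n P (s \<Lambda>))"
      by (rule one_dim_transfer[OF od, where T = ?T and T' = ?T'])
        (auto simp: T_mem T'_mem TT' T'T Kp peval_mult peval_Cst is_hom_Cst)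
    fix f assume f: "f \<in> Lpts m n P (s \<Lambda>)" "f \<noteq> 0"
    have f': "?T' f \<in> Lpts m n P' \<Lambda>"
      using T'_mem f(1) by blast
    have "?T' f \<noteq> 0"
      using TT'[OF Kp[OF f(1)]] f(2) by auto
    moreover have "eval_x f q = l powi \<Lambda> 0 * eval_x (?T' f) q'"
    proof -
      have "homog (?T' f) (\<Lambda> 0)"
        using f' by (simp add: Lpts_def)
      then have d: "0 \<le> \<Lambda> 0"
        using \<open>?T' f \<noteq> 0\<close> by (rule homog_neq_0_imp_nonneg)
      have "eval_x f q = eval_x (?T (?T' f)) q"
        using TT'[OF Kp[OF f(1)]] by simp
      also have "\<dots> = peval (\<lambda>c. c) (?T' f) (\<lambda>i. eval_x (g i) q)"
        by (simp add: eval_x_eq_peval peval_peval[of "\<lambda>c. c" "?T' f"] is_hom_id)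
      also have "\<dots> = peval (\<lambda>c. c) (?T' f) (\<lambda>i. l * q' i)"
        by (rule peval_cong_Kpoly[OF Kp[OF f']]) (rule l(2))
      also have "\<dots> = l ^ nat (\<Lambda> 0) * eval_x (?T' f) q'"
        by (simp add: peval_scale[OF \<open>homog (?T' f) (\<Lambda> 0)\<close>] eval_x_eq_peval)
      finally show ?thesis
        using d by (simp add: power_int_def)
    qed
    ultimately show "\<exists>f'\<in>Lpts m n P' \<Lambda>. f' \<noteq> 0 \<and> eval_x f q = l powi \<Lambda> 0 * eval_x f' q'"
      using f' by blast
  qed
qed

section \<open>The standard Cremona transformation\<close>

text \<open>This is \<open>x^\<delta> * f(1/x)\<close>: the Cremona pull-back with denominators
  cleared by the monomial \<open>x^\<delta>\<close>. Subtraction of exponents is truncated, so this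
  reading requires every exponent of f to be bounded by \<delta>.\<close>

definition cremona :: "mon \<Rightarrow> xpoly \<Rightarrow> xpoly" where
  "cremona \<delta> f = (\<Sum>\<alpha>\<in>keys f. single (\<delta> - \<alpha>) (lookup f \<alpha>))"

lemma cremona_superset:
  assumes "finite A" "keys f \<subseteq> A"
  shows "cremona \<delta> f = (\<Sum>\<alpha>\<in>A. single (\<delta> - \<alpha>) (lookup f \<alpha>))"
  unfolding cremona_def by (rule sum.mono_neutral_left) (use assms in \<open>auto simp: in_keys_iff\<close>)

lemma cremona_0 [simp]: "cremona \<delta> 0 = 0"
  by (simp add: cremona_def)

lemma cremona_single: "cremona \<delta> (single \<alpha> c) = single (\<delta> - \<alpha>) c"
  by (auto simp: cremona_def)

lemma cremona_add: "cremona \<delta> (f + g) = cremona \<delta> f + cremona \<delta> g"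
proof -
  let ?A = "keys f \<union> keys g"
  have "cremona \<delta> (f + g) = (\<Sum>\<alpha>\<in>?A. single (\<delta> - \<alpha>) (lookup (f + g) \<alpha>))"
    by (rule cremona_superset) (auto dest: keys_add[THEN subsetD])
  then show ?thesis
    by (simp add: lookup_add single_add sum.distrib cremona_superset[of ?A])
qed

lemma cremona_sum: "cremona \<delta> (sum f A) = (\<Sum>a\<in>A. cremona \<delta> (f a))"
  by (induction A rule: infinite_finite_induct) (auto simp: cremona_add)

lemma cremona_Cst_mult: "cremona \<delta> (Cst c * f) = Cst c * cremona \<delta> f"
proof (induction f rule: poly_add_induct)
  case (single \<alpha> d)
  show ?case
    by (simp add: Cst_def mult_single cremona_single)
qed (simp_all add: distrib_left cremona_add)

lemma lookup_diff_mon: "lookup ((\<delta> :: mon) - \<alpha>) i = lookup \<delta> i - lookup \<alpha> i"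
  by (simp add: minus_poly_mapping.rep_eq)

lemma diff_add_mon: "(\<And>i. lookup \<alpha> i \<le> lookup \<delta> i) \<Longrightarrow> (\<delta> :: mon) - \<alpha> + \<alpha> = \<delta>"
  by (rule poly_mapping_eqI) (simp add: lookup_add lookup_diff_mon)

lemma diff_diff_mon: "(\<And>i. lookup \<alpha> i \<le> lookup \<delta> i) \<Longrightarrow> (\<delta> :: mon) - (\<delta> - \<alpha>) = \<alpha>"
  by (rule poly_mapping_eqI) (simp add: lookup_diff_mon)

lemma cremona_cremona:
  assumes "\<And>\<alpha> i. \<alpha> \<in> keys f \<Longrightarrow> lookup \<alpha> i \<le> lookup \<delta> i"
  shows "cremona \<delta> (cremona \<delta> f) = f"
proof -
  have "cremona \<delta> (cremona \<delta> f) = (\<Sum>\<alpha>\<in>keys f. single (\<delta> - (\<delta> - \<alpha>)) (lookup f \<alpha>))"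
    by (simp add: cremona_def[of \<delta> f] cremona_sum cremona_single)
  also have "\<dots> = (\<Sum>\<alpha>\<in>keys f. single \<alpha> (lookup f \<alpha>))"
    by (rule sum.cong) (simp_all add: diff_diff_mon assms)
  finally show ?thesis
    by (simp flip: poly_sum_monomials)
qed

lemma keys_cremona:
  assumes "\<beta> \<in> keys (cremona \<delta> f)"
  obtains \<alpha> where "\<alpha> \<in> keys f" "\<beta> = \<delta> - \<alpha>"
proof -
  have "(\<Sum>\<alpha>\<in>keys f. lookup (single (\<delta> - \<alpha>) (lookup f \<alpha>)) \<beta>) \<noteq> 0"
    using assms by (simp add: cremona_def in_keys_iff lookup_sum)
  then obtain \<alpha> where "\<alpha> \<in> keys f" "lookup (single (\<delta> - \<alpha>) (lookup f \<alpha>)) \<beta> \<noteq> 0"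
    by (meson sum.not_neutral_contains_not_neutral)
  then show ?thesis
    using that by (auto simp: lookup_single)
qed

lemma peval_cremona:
  assumes h: "is_hom h" and le: "\<And>\<alpha> i. \<alpha> \<in> keys f \<Longrightarrow> lookup \<alpha> i \<le> lookup \<delta> i"
    and xy: "\<And>i. i \<in> keys \<delta> \<Longrightarrow> x i * y i = 1"
  shows "peval h (cremona \<delta> f) x = mono_eval x \<delta> * peval h f y"
proof -
  have "mono_eval x (\<delta> - \<alpha>) = mono_eval x \<delta> * mono_eval y \<alpha>" if a: "\<alpha> \<in> keys f" for \<alpha>
  proof -
    have "i \<in> keys \<delta>" if "i \<in> keys \<alpha>" for i
      using le[OF a, of i] that by (auto simp: in_keys_iff)
    then have "mono_eval (\<lambda>i. x i * y i) \<alpha> = mono_eval (\<lambda>_. 1) \<alpha>"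
      by (intro mono_eval_cong) (simp add: xy)
    then have "mono_eval x \<alpha> * mono_eval y \<alpha> = 1"
      by (simp add: mono_eval_mult mono_eval_const)
    moreover have "mono_eval x \<delta> = mono_eval x (\<delta> - \<alpha>) * mono_eval x \<alpha>"
      using diff_add_mon[of \<alpha> \<delta>] le[OF a] by (metis mono_eval_add)
    ultimately show ?thesis
      by (simp add: mult.assoc)
  qed
  moreover have "peval h (cremona \<delta> f) x = (\<Sum>\<alpha>\<in>keys f. h (lookup f \<alpha>) * mono_eval x (\<delta> - \<alpha>))"
    unfolding cremona_def is_hom_sum[OF is_hom_peval[OF h]]
    by (simp add: peval_single is_homD[OF h])
  ultimately show ?thesis
    by (simp add: peval_def sum_distrib_left mult_ac)
qed

text \<open>The order condition at the l-th coordinate point is a bound on the degree in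
  \<open>x_l\<close>. It dictates the clearing exponent \<Lambda> 0 + \<Lambda> l of the Cremona
  pull-back.\<close>

lemma Lpts_degree_bound:
  assumes "f \<in> Lpts m n P \<Lambda>" "m \<le> n" "\<And>j i. 1 \<le> j \<Longrightarrow> j \<le> m \<Longrightarrow> P j i = (if i = j then 1 else 0)"
    and "\<alpha> \<in> keys f" "l \<in> {1..m}"
  shows "int (lookup \<alpha> l) \<le> \<Lambda> 0 + \<Lambda> l"
proof -
  have "homog f (\<Lambda> 0)" "ord_ge f (P l) (- \<Lambda> l)"
    using assms(1,2,5) by (auto simp: Lpts_def)
  then show ?thesis
    using ord_ge_coordinate_point[of f "\<Lambda> 0" "P l" l] assms(3)[of l] assms(4,5) by fastforce
qed

text \<open>At a coordinate point the order only sees the exponent of one variable, which after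
  reflection is at most that of \<delta>. At any other point, inverting a curve through P j
  coordinatewise gives a curve through P' j. The hypotheses treat the two configurations alike, so
  the lemma serves both directions.\<close>

lemma cremona_mem_Lpts:
  assumes f: "f \<in> Lpts m n P' \<Lambda>'" and "m \<le> n"
    and P: "\<And>j i. 1 \<le> j \<Longrightarrow> j \<le> m \<Longrightarrow> P j i = (if i = j then 1 else 0)"
    and P': "\<And>j i. 1 \<le> j \<Longrightarrow> j \<le> m \<Longrightarrow> P' j i = (if i = j then 1 else 0)"
    and PP': "\<And>j i. m < j \<Longrightarrow> j \<le> n \<Longrightarrow> i \<in> {1..m} \<Longrightarrow> P j i * P' j i = 1"
    and keys_\<delta>: "keys \<delta> \<subseteq> {1..m}"
    and \<delta>: "\<And>l. l \<in> {1..m} \<Longrightarrow> int (lookup \<delta> l) = \<Lambda>' 0 + \<Lambda>' l"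
    and \<Lambda>: "\<And>l. l \<in> {1..m} \<Longrightarrow> \<Lambda> 0 + \<Lambda> l = \<Lambda>' 0 + \<Lambda>' l"
      "\<And>j. m < j \<Longrightarrow> j \<le> n \<Longrightarrow> \<Lambda> j = \<Lambda>' j" "\<Lambda> 0 + \<Lambda>' 0 = int (tdeg \<delta>)"
  shows "cremona \<delta> f \<in> Lpts m n P \<Lambda>" "\<alpha> \<in> keys f \<Longrightarrow> lookup \<alpha> i \<le> lookup \<delta> i"
proof -
  have Kf: "Kpoly m n f" and hf: "homog f (\<Lambda>' 0)"
    using f by (auto simp: Lpts_def)
  show le: "lookup \<alpha> i \<le> lookup \<delta> i" if "\<alpha> \<in> keys f" for \<alpha> i
  proof (cases "i \<in> {1..m}")
    case True
    then show ?thesis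
      using Lpts_degree_bound[OF f \<open>m \<le> n\<close> P' that True] \<delta>[OF True] by simp
  next
    case False
    then have "i \<notin> keys \<alpha>"
      using Kpoly_keys[OF Kf that] by blast
    then show ?thesis
      by (simp add: in_keys_iff)
  qed
  have "Kpoly m n (cremona \<delta> f)"
    unfolding cremona_def
  proof (intro Kpoly_sum Kpoly_single)
    fix \<alpha> assume "\<alpha> \<in> keys f"
    then show "lookup f \<alpha> \<in> Kfield m n"
      using Kf by (simp add: Kpoly_def)
    show "keys (\<delta> - \<alpha>) \<subseteq> {1..m}"
    proof
      fix i assume "i \<in> keys (\<delta> - \<alpha>)"
      then have "i \<in> keys \<delta>"
        by (auto simp: in_keys_iff lookup_diff_mon)
      then show "i \<in> {1..m}"
        using keys_\<delta> by blast
    qed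
  qed
  moreover have h: "homog (cremona \<delta> f) (\<Lambda> 0)"
    unfolding homog_def
  proof
    fix \<beta> assume "\<beta> \<in> keys (cremona \<delta> f)"
    then obtain \<alpha> where \<alpha>: "\<alpha> \<in> keys f" "\<beta> = \<delta> - \<alpha>"
      by (rule keys_cremona)
    then have "tdeg \<beta> + tdeg \<alpha> = tdeg \<delta>"
      using le by (simp add: diff_add_mon flip: tdeg_add)
    moreover have "int (tdeg \<alpha>) = \<Lambda>' 0"
      using hf \<alpha>(1) by (simp add: homog_def)
    ultimately show "int (tdeg \<beta>) = \<Lambda> 0"
      using \<Lambda>(3) by linarith
  qed
  moreover have "ord_ge (cremona \<delta> f) (P j) (- \<Lambda> j)" if j: "j \<in> {1..n}" for j
  proof (cases "j \<le> m")
    case True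
    have Pj: "P j i = (if i = j then 1 else 0)" for i
      using P j True by auto
    show ?thesis
      unfolding ord_ge_coordinate_point[OF h Pj]
    proof
      fix \<beta> assume "\<beta> \<in> keys (cremona \<delta> f)"
      then obtain \<alpha> where "\<beta> = \<delta> - \<alpha>"
        by (rule keys_cremona)
      then have "lookup \<beta> j \<le> lookup \<delta> j"
        by (simp add: lookup_diff_mon)
      then show "- \<Lambda> j \<le> \<Lambda> 0 - int (lookup \<beta> j)"
        using \<delta>[of j] \<Lambda>(1)[of j] j True by simp
    qed
  next
    case False
    have oj: "ord_ge f (P' j) (- \<Lambda> j)"
      using f j \<Lambda>(2)[of j] False by (auto simp: Lpts_def)
    show ?thesis
    proof (rule ord_geI)
      fix x assume x: "\<And>i. x i $ 0 = embE (Cst (P j i))"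
      \<comment> \<open>The relevant constant terms are nonzero since
        \<open>P j i * P' j i = 1\<close>, so these are genuine inverses of power series.\<close>
      let ?y = "\<lambda>i. inverse (x i)"
      have y: "?y i $ 0 = embE (Cst (P' j i))" "x i * ?y i = 1" if i: "i \<in> {1..m}" for i
      proof -
        have "embE (Cst (P j i)) * embE (Cst (P' j i)) = 1"
          using PP'[of j i] j False i
          by (simp add: is_homD[OF is_hom_embE] is_homD[OF is_hom_Cst]
              flip: is_homD(4)[OF is_hom_embE] is_homD(4)[OF is_hom_Cst])
        then show "?y i $ 0 = embE (Cst (P' j i))" "x i * ?y i = 1"
          using x[of i] by (fastforce simp: inverse_unique intro!: inverse_mult_eq_1')+
      qed
      have "fps_X ^ nat (- \<Lambda> j) dvd peval cst f ?y"
        by (rule ord_ge_curve[OF hf oj, where l = 1 and A = "{1..m}"])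
          (use y Kpoly_keys[OF Kf] in auto)
      moreover have "peval cst (cremona \<delta> f) x = mono_eval x \<delta> * peval cst f ?y"
        by (rule peval_cremona[OF is_hom_cst le]) (use y(2) keys_\<delta> in auto)
      ultimately show "fps_X ^ nat (- \<Lambda> j) dvd peval cst (cremona \<delta> f) x"
        by simp
    qed
  qed
  ultimately show "cremona \<delta> f \<in> Lpts m n P \<Lambda>"
    by (simp add: Lpts_def)
qed

text \<open>The same operation \<open>cremona \<delta>\<close> goes in both directions, since
  \<Lambda> 0 + \<Lambda> l is invariant under s. The factor at q is the value
  \<open>q^\<delta>\<close>, whose exponents are additive in \<Lambda>.\<close>

lemma Lstep_cremona:
  assumes "m \<le> n"
    and P: "\<And>j i. 1 \<le> j \<Longrightarrow> j \<le> m \<Longrightarrow> P j i = (if i = j then 1 else 0)"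
    and P': "\<And>j i. 1 \<le> j \<Longrightarrow> j \<le> m \<Longrightarrow> P' j i = (if i = j then 1 else 0)"
    and PP': "\<And>j i. m < j \<Longrightarrow> j \<le> n \<Longrightarrow> i \<in> {1..m} \<Longrightarrow> P j i * P' j i = 1"
    and q: "\<And>i. i \<in> {1..m} \<Longrightarrow> q i * q' i = 1"
    and s: "\<And>\<Lambda> l. l \<in> {1..m} \<Longrightarrow> s \<Lambda> 0 + s \<Lambda> l = \<Lambda> 0 + \<Lambda> l"
      "\<And>\<Lambda> j. m < j \<Longrightarrow> j \<le> n \<Longrightarrow> s \<Lambda> j = \<Lambda> j"
      "\<And>\<Lambda>. s \<Lambda> 0 + \<Lambda> 0 = (\<Sum>l\<in>{1..m}. \<Lambda> 0 + \<Lambda> l)"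
  shows "Lstep m n P q P' q' s"
proof -
  let ?u = "\<lambda>\<Lambda> :: nat \<Rightarrow> int. \<Prod>l\<in>{1..m}. q l powi (\<Lambda> 0 + \<Lambda> l)"
  have q0: "q i \<noteq> 0" if "i \<in> {1..m}" for i
    using q[OF that] by auto
  show ?thesis
    unfolding Lstep_def
  proof (intro exI[of _ ?u] conjI allI impI ballI)
    show "?u \<Lambda> \<noteq> 0" for \<Lambda>
      using q0 by simp
    show "?u (\<lambda>i. \<Lambda> i + H i) = ?u \<Lambda> * ?u H" for \<Lambda> H
      unfolding prod.distrib[symmetric]
      by (rule prod.cong) (use q0 in \<open>simp_all add: power_int_add[symmetric] algebra_simps\<close>)
    fix \<Lambda> assume od: "one_dim m n (Lpts m n P' \<Lambda>)"
    then obtain f0 where f0: "f0 \<in> Lpts m n P' \<Lambda>" "f0 \<noteq> 0"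
      unfolding one_dim_def by blast
    obtain \<alpha>0 where "\<alpha>0 \<in> keys f0"
      using f0(2) by (metis poly_sum_monomials sum.empty equals0I)
    \<comment> \<open>A nonzero form bounds these exponents below by 0, so the conversion by
      \<open>nat\<close> in \<delta> loses nothing.\<close>
    then have nonneg: "0 \<le> \<Lambda> 0 + \<Lambda> l" if "l \<in> {1..m}" for l
      using Lpts_degree_bound[OF f0(1) \<open>m \<le> n\<close> P' _ that, of \<alpha>0] by simp
    define \<delta> :: mon where "\<delta> = (\<Sum>l\<in>{1..m}. single l (nat (\<Lambda> 0 + \<Lambda> l)))"
    have lookup_\<delta>: "lookup \<delta> i = (if i \<in> {1..m} then nat (\<Lambda> 0 + \<Lambda> i) else 0)" for i
    proof -
      have "lookup \<delta> i = (\<Sum>l\<in>{1..m}. if i = l then nat (\<Lambda> 0 + \<Lambda> l) else 0)"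
        unfolding \<delta>_def lookup_sum by (rule sum.cong) (auto simp: lookup_single when_def)
      then show ?thesis
        by simp
    qed
    have keys_\<delta>: "keys \<delta> \<subseteq> {1..m}"
      by (auto simp: in_keys_iff lookup_\<delta> split: if_splits)
    have \<delta>: "int (lookup \<delta> l) = \<Lambda> 0 + \<Lambda> l" if "l \<in> {1..m}" for l
      using that nonneg[OF that] by (simp add: lookup_\<delta>)
    have deg: "int (tdeg \<delta>) = s \<Lambda> 0 + \<Lambda> 0"
      using \<delta> by (simp add: s(3) tdeg_superset[OF _ keys_\<delta>])
    have mem: "cremona \<delta> f \<in> Lpts m n P (s \<Lambda>)" "\<alpha> \<in> keys f \<Longrightarrow> lookup \<alpha> i \<le> lookup \<delta> i"
      if "f \<in> Lpts m n P' \<Lambda>" for f \<alpha> i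
      using cremona_mem_Lpts[OF that \<open>m \<le> n\<close> P P' PP' keys_\<delta> \<delta> s(1,2) deg[symmetric]] by auto
    have \<delta>': "int (lookup \<delta> l) = s \<Lambda> 0 + s \<Lambda> l" if "l \<in> {1..m}" for l
      using \<delta>[OF that] s(1)[OF that] by simp
    have P'P: "P' j i * P j i = 1" if "m < j" "j \<le> n" "i \<in> {1..m}" for j i
      using PP'[OF that] by (simp add: mult.commute)
    have mem': "cremona \<delta> f \<in> Lpts m n P' \<Lambda>" "\<alpha> \<in> keys f \<Longrightarrow> lookup \<alpha> i \<le> lookup \<delta> i"
      if "f \<in> Lpts m n P (s \<Lambda>)" for f \<alpha> i
      using cremona_mem_Lpts[OF that \<open>m \<le> n\<close> P' P P'P keys_\<delta> \<delta>'] s(1,2) deg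
      by (auto simp: add.commute)
    show "one_dim m n (Lpts m n P (s \<Lambda>))"
      by (rule one_dim_transfer[OF od, where T = "cremona \<delta>" and T' = "cremona \<delta>"])
        (auto simp: mem mem' cremona_cremona cremona_Cst_mult)
    fix f assume f: "f \<in> Lpts m n P (s \<Lambda>)" "f \<noteq> 0"
    let ?f' = "cremona \<delta> f"
    have inv: "cremona \<delta> ?f' = f"
      by (rule cremona_cremona) (rule mem'(2)[OF f(1)])
    have "eval_x (cremona \<delta> ?f') q = mono_eval q \<delta> * eval_x ?f' q'"
      unfolding eval_x_eq_peval
      by (rule peval_cremona[OF is_hom_id mem(2)[OF mem'(1)[OF f(1)]]]) (use q keys_\<delta> in auto)
    moreover have "mono_eval q \<delta> = ?u \<Lambda>"
    proof -
      have "mono_eval q \<delta> = (\<Prod>l\<in>{1..m}. q l ^ lookup \<delta> l)"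
        by (rule mono_eval_superset) (use keys_\<delta> in auto)
      also have "\<dots> = ?u \<Lambda>"
        by (rule prod.cong) (simp_all flip: \<delta>)
      finally show ?thesis .
    qed
    moreover have "?f' \<noteq> 0"
      using inv f(2) by auto
    ultimately show "\<exists>f'\<in>Lpts m n P' \<Lambda>. f' \<noteq> 0 \<and> eval_x f q = ?u \<Lambda> * eval_x f' q'"
      using mem'(1)[OF f(1)] inv by auto
  qed
qed

section \<open>Simple reflections\<close>

definition std_pt :: "nat \<Rightarrow> (nat \<Rightarrow> nat \<Rightarrow> fld) \<Rightarrow> nat \<Rightarrow> nat \<Rightarrow> fld" where
  "std_pt m C j i = (if j \<le> m then (if i = j then 1 else 0) else if j = m + 1 \<or> i = m then 1 else C j i)"

definition swap_adj :: "nat \<Rightarrow> nat \<Rightarrow> nat" where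
  "swap_adj k j = (if j = k then k + 1 else if j = k + 1 then k else j)"

lemma swap_adj_image:
  assumes "1 \<le> k" "k < n" shows "swap_adj k ` {1..n} = {1..n}"
proof -
  have "swap_adj k j \<in> {1..n}" "swap_adj k (swap_adj k j) = j" if "j \<in> {1..n}" for j
    using that assms by (auto simp: swap_adj_def)
  then show ?thesis
    by (metis image_subsetI subset_antisym subsetI image_eqI)
qed

lemma bil_hroot_pos:
  assumes "1 \<le> k" "k < n" shows "bil m n (hroot m k) \<Lambda> = \<Lambda> k - \<Lambda> (k + 1)"
proof -
  have "(\<Sum>j=1..n. (e k j - e (k + 1) j) * \<Lambda> j) =
      (\<Sum>j=1..n. if j = k then \<Lambda> j else 0) - (\<Sum>j=1..n. if j = k + 1 then \<Lambda> j else 0)"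
    unfolding sum_subtractf[symmetric] by (rule sum.cong) (auto simp: e_def)
  also have "\<dots> = \<Lambda> k - \<Lambda> (k + 1)"
    using assms by (simp add: sum.delta)
  finally show ?thesis
    using assms by (simp add: bil_def hroot_def e_def)
qed

lemma bil_hroot_0:
  assumes "m \<le> n" shows "bil m n (hroot m 0) \<Lambda> = - (int m - 2) * \<Lambda> 0 - (\<Sum>j=1..m. \<Lambda> j)"
proof -
  have "(\<Sum>j=1..n. hroot m 0 j * \<Lambda> j) = (\<Sum>j=1..m. - \<Lambda> j)"
    by (rule sum.mono_neutral_cong_right) (use assms in \<open>auto simp: hroot_def\<close>)
  then show ?thesis
    by (simp add: bil_def hroot_def sum_negf)
qed

lemma refl_L_pos:
  assumes "1 \<le> k" "k < n"
  shows "refl_L m n k \<Lambda> 0 = \<Lambda> 0" "refl_L m n k \<Lambda> (swap_adj k j) = \<Lambda> j"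
  unfolding refl_L_def bil_hroot_pos[OF assms]
  using assms by (auto simp: hroot_def e_def swap_adj_def)

text \<open>These are the classical degree rules of the Cremona map: d becomes (m-1) d minus the sum
  of the first m multiplicities, while each difference \<open>d - \<nu>_l\<close> is kept. They are
  stated in the form in which the clearing exponents use them.\<close>

lemma refl_L_0:
  assumes "m \<le> n"
  shows "l \<in> {1..m} \<Longrightarrow> refl_L m n 0 \<Lambda> 0 + refl_L m n 0 \<Lambda> l = \<Lambda> 0 + \<Lambda> l"
    and "m < j \<Longrightarrow> refl_L m n 0 \<Lambda> j = \<Lambda> j"
    and "refl_L m n 0 \<Lambda> 0 + \<Lambda> 0 = (\<Sum>l\<in>{1..m}. \<Lambda> 0 + \<Lambda> l)"
proof -
  show "l \<in> {1..m} \<Longrightarrow> refl_L m n 0 \<Lambda> 0 + refl_L m n 0 \<Lambda> l = \<Lambda> 0 + \<Lambda> l"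
    and "m < j \<Longrightarrow> refl_L m n 0 \<Lambda> j = \<Lambda> j"
    by (auto simp: refl_L_def hroot_def)
  have "hroot m 0 0 = 1"
    by (simp add: hroot_def)
  then show "refl_L m n 0 \<Lambda> 0 + \<Lambda> 0 = (\<Sum>l\<in>{1..m}. \<Lambda> 0 + \<Lambda> l)"
    by (simp add: refl_L_def bil_hroot_0[OF assms] sum.distrib algebra_simps)
qed

lemma Lstep_diagonal:
  assumes c: "\<And>i. i \<in> {1..m} \<Longrightarrow> c i \<in> Kfield m n \<and> c i \<noteq> 0"
    and \<sigma>: "\<sigma> ` {1..n} = {1..n}"
    and P: "\<And>j. j \<in> {1..n} \<Longrightarrow> \<exists>l. l \<noteq> 0 \<and> (\<forall>i\<in>{1..m}. c i * P (\<sigma> j) i = l * P' j i)"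
    and q: "\<exists>l. l \<noteq> 0 \<and> (\<forall>i\<in>{1..m}. c i * q i = l * q' i)"
    and s: "\<And>\<Lambda>. s \<Lambda> 0 = \<Lambda> 0" "\<And>\<Lambda> j. j \<in> {1..n} \<Longrightarrow> s \<Lambda> (\<sigma> j) = \<Lambda> j"
  shows "Lstep m n P q P' q' s"
proof (rule Lstep_linear[where g = "\<lambda>i. Cst (c i) * Xv i" and g' = "\<lambda>i. Cst (inverse (c i)) * Xv i" and \<sigma> = \<sigma>])
  have Cst_mult: "Cst a * (Cst b * f) = Cst (a * b) * f" for a b f
    by (simp add: is_homD[OF is_hom_Cst] mult.assoc)
  have Cst_1: "Cst 1 = 1"
    by (simp add: is_homD[OF is_hom_Cst])
  have hom: "homog (Cst a * Xv i) 1" for a i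
    using homog_mult[OF homog_Cst homog_Xv] by simp
  fix i assume i: "i \<in> {1..m}"
  show "Kpoly m n (Cst (c i) * Xv i) \<and> homog (Cst (c i) * Xv i) 1"
    "Kpoly m n (Cst (inverse (c i)) * Xv i) \<and> homog (Cst (inverse (c i)) * Xv i) 1"
    using c[OF i] i by (auto intro!: Kpoly_mult Kpoly_Cst Kpoly_Xv Kfield_inverse hom)
  show "peval Cst (Cst (c i) * Xv i) (\<lambda>i. Cst (inverse (c i)) * Xv i) = Xv i"
    "peval Cst (Cst (inverse (c i)) * Xv i) (\<lambda>i. Cst (c i) * Xv i) = Xv i"
    using c[OF i] by (simp_all add: peval_mult peval_Cst peval_Xv is_hom_Cst Cst_mult Cst_1)
next
  have ev: "eval_x (Cst a * Xv i) p = a * p i" for a i p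
    by (simp add: eval_x_eq_peval peval_mult peval_Cst peval_Xv is_hom_id)
  show "\<exists>l. l \<noteq> 0 \<and> (\<forall>i\<in>{1..m}. eval_x (Cst (c i) * Xv i) (P (\<sigma> j)) = l * P' j i)" if "j \<in> {1..n}" for j
    using P[OF that] by (simp add: ev)
  show "\<exists>l. l \<noteq> 0 \<and> (\<forall>i\<in>{1..m}. eval_x (Cst (c i) * Xv i) q = l * q' i)"
    using q by (simp add: ev)
qed (use \<sigma> s in auto)

text \<open>Each generator is realized by an explicit map: the Cremona map for k = 0, a
  transposition of coordinates for 0 < k < m, the involution \<open>x_i -> x_m - x_i\<close> for i <
  m fixing \<open>x_m\<close> for k = m, the diagonal map sending \<open>p_(m+2)\<close> to
  (1:...:1) for k = m + 1, and the identity beyond that.\<close>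

lemma Lstep_cfg_step:
  assumes m: "1 < m" "m < n" and k: "k < n"
    and K: "\<And>j i. m + 2 \<le> j \<Longrightarrow> j \<le> n \<Longrightarrow> 1 \<le> i \<Longrightarrow> i \<le> m - 1 \<Longrightarrow> C j i \<in> Kfield m n"
    and nz: "\<And>j i. m + 2 \<le> j \<Longrightarrow> j \<le> n + 1 \<Longrightarrow> 1 \<le> i \<Longrightarrow> i \<le> m - 1 \<Longrightarrow> C j i \<noteq> 0"
  shows "Lstep m n (std_pt m C) (std_pt m C (n + 1)) (std_pt m (cfg_step m k C))
     (std_pt m (cfg_step m k C) (n + 1)) (refl_L m n k)"
proof -
  let ?P = "std_pt m C" and ?P' = "std_pt m (cfg_step m k C)"
  \<comment> \<open>Because k < n the point q is never moved, so one condition on the rows up to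
    \<open>n + 1\<close> covers both the points and q.\<close>
  have swap_last: "swap_adj k (n + 1) = n + 1"
    using k by (simp add: swap_adj_def)
  have refl: "1 \<le> k \<Longrightarrow> refl_L m n k \<Lambda> 0 = \<Lambda> 0" "1 \<le> k \<Longrightarrow> refl_L m n k \<Lambda> (swap_adj k j) = \<Lambda> j" for \<Lambda> j
    using refl_L_pos k by auto
  have diag: ?thesis
    if "1 \<le> k" and c: "\<And>i. i \<in> {1..m} \<Longrightarrow> c i \<in> Kfield m n \<and> c i \<noteq> 0"
    and pts: "\<And>j. j \<in> {1..n + 1} \<Longrightarrow> \<exists>l. l \<noteq> 0 \<and> (\<forall>i\<in>{1..m}. c i * ?P (swap_adj k j) i = l * ?P' j i)" for c
    by (rule Lstep_diagonal[OF c swap_adj_image[OF \<open>1 \<le> k\<close> k]])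
      (use pts pts[of "n + 1", unfolded swap_last] refl \<open>1 \<le> k\<close> in auto)
  have linear: ?thesis
    if "1 \<le> k" and g: "\<And>i. i \<in> {1..m} \<Longrightarrow> Kpoly m n (g i) \<and> homog (g i) 1"
    and gg: "\<And>i. i \<in> {1..m} \<Longrightarrow> peval Cst (g i) g = Xv i"
    and pts: "\<And>j. j \<in> {1..n + 1} \<Longrightarrow> \<exists>l. l \<noteq> 0 \<and> (\<forall>i\<in>{1..m}. eval_x (g i) (?P (swap_adj k j)) = l * ?P' j i)" for g
    by (rule Lstep_linear[OF g g gg gg swap_adj_image[OF \<open>1 \<le> k\<close> k]])
      (use pts pts[of "n + 1", unfolded swap_last] refl \<open>1 \<le> k\<close> in auto)
  have swap: ?thesis
    if "1 \<le> k" "k < m"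
    and pts: "\<And>j. j \<in> {1..n + 1} \<Longrightarrow> \<exists>l. l \<noteq> 0 \<and> (\<forall>i\<in>{1..m}. ?P (swap_adj k j) (swap_adj k i) = l * ?P' j i)"
  proof (rule linear[where g = "\<lambda>i. Xv (swap_adj k i)"])
    show "Kpoly m n (Xv (swap_adj k i)) \<and> homog (Xv (swap_adj k i)) 1" if "i \<in> {1..m}" for i
      using that \<open>k < m\<close> \<open>1 \<le> k\<close> by (auto simp: swap_adj_def intro!: Kpoly_Xv homog_Xv)
    show "peval Cst (Xv (swap_adj k i)) (\<lambda>i. Xv (swap_adj k i)) = Xv i" for i
      by (simp add: peval_Xv is_hom_Cst) (simp add: swap_adj_def)
  qed (use pts that in \<open>auto simp: eval_x_eq_peval peval_Xv is_hom_id\<close>)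
  show ?thesis
  proof (cases rule: generator_cases[where k = k and m = m])
    case 1
    show ?thesis
      unfolding 1
    proof (rule Lstep_cremona)
      show "std_pt m C j i * std_pt m (cfg_step m 0 C) j i = 1"
        if "m < j" "j \<le> n" "i \<in> {1..m}" for j i
        using nz[of j i] that m by (auto simp: std_pt_def cfg_step_simps)
      show "std_pt m C (n + 1) i * std_pt m (cfg_step m 0 C) (n + 1) i = 1" if "i \<in> {1..m}" for i
        using nz[of "n + 1" i] that m by (auto simp: std_pt_def cfg_step_simps)
    qed (use m refl_L_0 in \<open>auto simp: std_pt_def\<close>)
  next
    case 2
    show ?thesis
    proof (rule swap)
      show "\<exists>l. l \<noteq> 0 \<and> (\<forall>i\<in>{1..m}. ?P (swap_adj k j) (swap_adj k i) = l * ?P' j i)" for j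
        by (rule exI[of _ 1]) (use 2 m in \<open>auto simp: std_pt_def swap_adj_def cfg_step_simps\<close>)
    qed (use 2 in auto)
  next
    case 3
    show ?thesis
    proof (rule swap)
      fix j assume j: "j \<in> {1..n + 1}"
      show "\<exists>l. l \<noteq> 0 \<and> (\<forall>i\<in>{1..m}. ?P (swap_adj k j) (swap_adj k i) = l * ?P' j i)"
      proof (cases "m + 2 \<le> j")
        case True
        have "C j (m - 1) \<noteq> 0"
          using nz[of j "m - 1"] True j m by simp
        then show ?thesis
          \<comment> \<open>After the swap the last coordinate is \<open>C j (m - 1)\<close>; the
            scalar restores the normalization to 1.\<close>
          using 3 m True by (intro exI[of _ "C j (m - 1)"])
            (auto simp: std_pt_def swap_adj_def cfg_step_simps simp del: One_nat_def)
      next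
        case False
        then show ?thesis
          using 3 m by (intro exI[of _ 1]) (auto simp: std_pt_def swap_adj_def)
      qed
    qed (use 3 in auto)
  next
    case 4
    let ?g = "\<lambda>i. if i = m then Xv m else Xv m - Xv i"
    have ev: "eval_x (?g i) p = (if i = m then p m else p m - p i)" for i p
      by (simp add: eval_x_eq_peval peval_Xv is_hom_id is_hom_diff[OF is_hom_peval])
    show ?thesis
    proof (rule linear)
      show "Kpoly m n (?g i) \<and> homog (?g i) 1" if "i \<in> {1..m}" for i
        using that by (auto intro!: Kpoly_Xv Kpoly_diff homog_Xv homog_diff)
      show "peval Cst (?g i) ?g = Xv i" for i
        by (simp add: peval_Xv is_hom_Cst is_hom_diff[OF is_hom_peval])
      fix j assume j: "j \<in> {1..n + 1}"
      show "\<exists>l. l \<noteq> 0 \<and> (\<forall>i\<in>{1..m}. eval_x (?g i) (?P (swap_adj k j)) = l * ?P' j i)"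
        unfolding ev
        \<comment> \<open>The involution sends the j-th coordinate vector to its negative for j < m,
          and exchanges the m-th one with (1,...,1).\<close>
        by (rule exI[of _ "if j < m then -1 else 1"])
          (use 4 m in \<open>auto simp: std_pt_def swap_adj_def cfg_step_simps\<close>)
    qed (use 4 m in auto)
  next
    case 5
    let ?c = "\<lambda>i. if i = m then 1 else inverse (C (m + 2) i)"
    \<comment> \<open>Here k = m + 1 < n, so \<open>p_(m+2)\<close> is one of the first n points and
      its coordinates lie in the ground field.\<close>
    have c: "?c i \<in> Kfield m n" "?c i \<noteq> 0" if "i \<in> {1..m}" for i
    proof -
      have "i = m \<or> i \<le> m - 1"
        using that by auto
      then show "?c i \<in> Kfield m n" "?c i \<noteq> 0"
        using K[of "m + 2" i] nz[of "m + 2" i] that 5 k m by (auto intro!: Kfield_inverse)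
    qed
    show ?thesis
    proof (rule diag[where c = ?c])
      fix j assume j: "j \<in> {1..n + 1}"
      show "\<exists>l. l \<noteq> 0 \<and> (\<forall>i\<in>{1..m}. ?c i * ?P (swap_adj k j) i = l * ?P' j i)"
      proof (cases "j \<le> m")
        case True
        then show ?thesis
          using 5 m c(2)[of j] j by (intro exI[of _ "?c j"]) (auto simp: std_pt_def swap_adj_def)
      next
        case False
        have nz_row: "C (m + 2) i \<noteq> 0" if "i \<noteq> m" "1 \<le> i" "i \<le> m" for i
          using nz[of "m + 2" i] that 5 k by simp
        have next_row: "m + 1 + 1 = m + 2"
          by simp
        show ?thesis
          using 5 False nz_row
          by (intro exI[of _ 1]) (auto simp: std_pt_def swap_adj_def cfg_step_simps[OF m(1)] divide_inverse next_row
              simp del: One_nat_def add_2_eq_Suc add_2_eq_Suc')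
      qed
    qed (use c 5 in auto)
  next
    case 6
    show ?thesis
    proof (rule diag[where c = "\<lambda>_. 1"])
      show "\<exists>l. l \<noteq> 0 \<and> (\<forall>i\<in>{1..m}. 1 * ?P (swap_adj k j) i = l * ?P' j i)" for j
        by (rule exI[of _ 1]) (use 6 m in \<open>auto simp: std_pt_def swap_adj_def cfg_step_simps\<close>)
    qed (use 6 in auto)
  qed
qed

section \<open>Induction along words\<close>

text \<open>Row \<open>n + 1\<close> is q and depends on z, so membership in the ground field stops
  at row n, whereas nonvanishing includes q. Quantifying over all words makes the property pass to
  every stepped configuration.\<close>

definition good_cfg :: "nat \<Rightarrow> nat \<Rightarrow> (nat \<Rightarrow> nat \<Rightarrow> fld) \<Rightarrow> bool" where
  "good_cfg m n C \<longleftrightarrow>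
     (\<forall>j i. m + 2 \<le> j \<longrightarrow> j \<le> n \<longrightarrow> 1 \<le> i \<longrightarrow> i \<le> m - 1 \<longrightarrow> C j i \<in> Kfield m n) \<and>
     (\<forall>w\<in>lists {0..<n}. \<forall>j i. m + 2 \<le> j \<longrightarrow> j \<le> n + 1 \<longrightarrow> 1 \<le> i \<longrightarrow> i \<le> m - 1 \<longrightarrow> cfg_act m w C j i \<noteq> 0)"

text \<open>Since k < n, no step brings entries of row \<open>n + 1\<close> into the rows up to n,
  which therefore stay in the ground field.\<close>

lemma good_cfg_step:
  assumes "good_cfg m n C" "k < n" "1 < m"
  shows "good_cfg m n (cfg_step m k C)"
  unfolding good_cfg_def
proof (intro conjI ballI allI impI)
  have K: "C j i \<in> Kfield m n" if "m + 2 \<le> j" "j \<le> n" "1 \<le> i" "i \<le> m - 1" for j i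
    using assms(1) that by (simp add: good_cfg_def)
  show "cfg_step m k C j i \<in> Kfield m n" if ji: "m + 2 \<le> j" "j \<le> n" "1 \<le> i" "i \<le> m - 1" for j i
    by (cases rule: generator_cases[where k = k and m = m])
      (use ji assms(2,3) in \<open>auto simp: cfg_step_simps simp del: One_nat_def add_2_eq_Suc add_2_eq_Suc'
        intro!: K Kfield_inverse Kfield_divide Kfield_diff\<close>)
  show "cfg_act m w (cfg_step m k C) j i \<noteq> 0"
    if "w \<in> lists {0..<n}" "m + 2 \<le> j" "j \<le> n + 1" "1 \<le> i" "i \<le> m - 1" for w j i
  proof -
    have "k # w \<in> lists {0..<n}"
      using that(1) assms(2) by simp
    then have "cfg_act m (k # w) C j i \<noteq> 0"
      using assms(1) that unfolding good_cfg_def by blast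
    then show ?thesis
      by simp
  qed
qed

lemma good_cfg_Lstep:
  assumes "good_cfg m n C" "k < n" "1 < m" "m < n"
  shows "Lstep m n (std_pt m C) (std_pt m C (n + 1)) (std_pt m (cfg_step m k C))
     (std_pt m (cfg_step m k C) (n + 1)) (refl_L m n k)"
proof (rule Lstep_cfg_step[OF assms(3,4,2)])
  show "C j i \<in> Kfield m n" if "m + 2 \<le> j" "j \<le> n" "1 \<le> i" "i \<le> m - 1" for j i
    using assms(1) that by (simp add: good_cfg_def)
  show "C j i \<noteq> 0" if "m + 2 \<le> j" "j \<le> n + 1" "1 \<le> i" "i \<le> m - 1" for j i
    using assms(1) that unfolding good_cfg_def by (metis cfg_act.simps(1) lists.Nil)
qed

lemma good_gen_cfg:
  assumes "1 < m" "m < n" shows "good_cfg m n (gen_cfg n)"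
  unfolding good_cfg_def using assms cfg_act_gen_cfg_neq_0 by (auto simp: gen_cfg_def U_in_Kfield)

lemma ord_ge_nonpos: "\<nu> \<le> 0 \<Longrightarrow> ord_ge f p \<nu>"
  by (auto simp: ord_ge_def)

lemma Lpts_e:
  assumes "1 \<le> i" shows "Lpts m n P (e i) = Cst ` Kfield m n"
proof
  show "Cst ` Kfield m n \<subseteq> Lpts m n P (e i)"
    using assms by (auto simp: Lpts_def e_def Kpoly_Cst homog_Cst intro!: ord_ge_nonpos)
  show "Lpts m n P (e i) \<subseteq> Cst ` Kfield m n"
  proof
    fix f assume f: "f \<in> Lpts m n P (e i)"
    have "lookup f \<alpha> = 0" if "\<alpha> \<noteq> 0" for \<alpha>
    proof (rule ccontr)
      assume nz: "lookup f \<alpha> \<noteq> 0"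
      have "tdeg \<alpha> = 0"
        using f assms nz by (auto simp: Lpts_def e_def homog_altdef)
      then have "\<alpha> = 0"
        by (auto simp: tdeg_def in_keys_iff intro!: poly_mapping_eqI)
      then show False
        using that by simp
    qed
    then have "f = Cst (lookup f 0)"
      unfolding Cst_def by (intro poly_mapping_eqI) (auto simp: lookup_single when_def)
    moreover have "lookup f 0 \<in> Kfield m n"
      using f by (simp add: Lpts_def Kpoly_altdef)
    ultimately show "f \<in> Cst ` Kfield m n"
      by blast
  qed
qed

text \<open>The first letter of a word acts first on configurations and last on the lattice. This
  matches the direction of \<open>Lstep\<close>, from the stepped configuration back to C, and the
  induction hypothesis is applied at the stepped configuration.\<close>

lemma one_dim_orbit:
  assumes "1 < m" "m < n" "w \<in> lists {0..<n}" "good_cfg m n C" "1 \<le> i"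
  shows "one_dim m n (Lpts m n (std_pt m C) (act_L m n w (e i)))"
  using assms(3,4)
proof (induction w arbitrary: C rule: list.induct)
  case Nil
  have "\<exists>c\<in>Kfield m n. g = Cst c * Cst 1" if "g \<in> Cst ` Kfield m n" for g
    using that by (auto simp: is_homD[OF is_hom_Cst])
  then show ?case
    unfolding one_dim_def act_L.simps Lpts_e[OF assms(5)]
    by (intro bexI[of _ "Cst 1"]) (auto simp: Cst_eq_0_iff)
next
  case (Cons k w)
  then show ?case
    using good_cfg_Lstep[of m n C k] good_cfg_step[of m n C k] assms(1,2)
    by (auto simp: Lstep_def)
qed

text \<open>The target v is kept apart from q: along the induction the reference configuration
  changes while the final position of the moved point stays the same.\<close>

definition ratio_formula :: "nat \<Rightarrow> nat \<Rightarrow> (nat \<Rightarrow> nat \<Rightarrow> fld) \<Rightarrow> (nat \<Rightarrow> fld) \<Rightarrow> (nat \<Rightarrow> fld)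
    \<Rightarrow> (nat \<Rightarrow> nat \<Rightarrow> int) \<Rightarrow> (nat \<Rightarrow> nat \<Rightarrow> int) \<Rightarrow> bool" where
  "ratio_formula m n P q v A B \<longleftrightarrow> (\<forall>F G.
     (\<forall>i\<in>{1..m}. F i \<in> Lpts m n P (A i) \<and> F i \<noteq> 0 \<and> G i \<in> Lpts m n P (B i) \<and> G i \<noteq> 0) \<longrightarrow>
     (\<exists>c. (\<forall>i\<in>{1..m}. c i \<in> Kfield m n \<and> c i \<noteq> 0) \<and>
        proj_eq m v (\<lambda>i. c i * eval_x (G i) q / eval_x (F i) q)))"

text \<open>Since B i and A i differ by the same H for all i, each quotient changes by the single
  factor \<open>u H\<close>. That factor may involve z, so it goes into the projective scalar, and
  the constants c are left unchanged.\<close>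

lemma ratio_formula_Lstep:
  assumes L: "Lstep m n P q P' q' s"
    and A: "\<And>i. i \<in> {1..m} \<Longrightarrow> one_dim m n (Lpts m n P' (A i))"
    and B: "\<And>i. i \<in> {1..m} \<Longrightarrow> one_dim m n (Lpts m n P' (B i))"
    and AB: "\<And>i. i \<in> {1..m} \<Longrightarrow> B i = (\<lambda>j. A i j + H j)"
    and r: "ratio_formula m n P' q' v A B"
  shows "ratio_formula m n P q v (\<lambda>i. s (A i)) (\<lambda>i. s (B i))"
  unfolding ratio_formula_def
proof (intro allI impI)
  fix F G
  assume FG: "\<forall>i\<in>{1..m}. F i \<in> Lpts m n P (s (A i)) \<and> F i \<noteq> 0 \<and> G i \<in> Lpts m n P (s (B i)) \<and> G i \<noteq> 0"
  obtain u :: "(nat \<Rightarrow> int) \<Rightarrow> fld" where u: "\<And>\<Lambda>. u \<Lambda> \<noteq> 0"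
      "\<And>\<Lambda> H. u (\<lambda>i. \<Lambda> i + H i) = u \<Lambda> * u H"
      "\<And>\<Lambda> f. one_dim m n (Lpts m n P' \<Lambda>) \<Longrightarrow> f \<in> Lpts m n P (s \<Lambda>) \<Longrightarrow> f \<noteq> 0 \<Longrightarrow>
           (\<exists>f'\<in>Lpts m n P' \<Lambda>. f' \<noteq> 0 \<and> eval_x f q = u \<Lambda> * eval_x f' q')"
    using L unfolding Lstep_def by blast
  have "\<forall>i\<in>{1..m}. \<exists>f'. f' \<in> Lpts m n P' (A i) \<and> f' \<noteq> 0 \<and> eval_x (F i) q = u (A i) * eval_x f' q'"
    using u(3)[OF A] FG by blast
  then obtain F' where F': "\<forall>i\<in>{1..m}. F' i \<in> Lpts m n P' (A i) \<and> F' i \<noteq> 0 \<and>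
      eval_x (F i) q = u (A i) * eval_x (F' i) q'"
    by (rule bchoice[THEN exE])
  have "\<forall>i\<in>{1..m}. \<exists>f'. f' \<in> Lpts m n P' (B i) \<and> f' \<noteq> 0 \<and> eval_x (G i) q = u (B i) * eval_x f' q'"
    using u(3)[OF B] FG by blast
  then obtain G' where G': "\<forall>i\<in>{1..m}. G' i \<in> Lpts m n P' (B i) \<and> G' i \<noteq> 0 \<and>
      eval_x (G i) q = u (B i) * eval_x (G' i) q'"
    by (rule bchoice[THEN exE])
  obtain c t where c: "\<forall>i\<in>{1..m}. c i \<in> Kfield m n \<and> c i \<noteq> 0" and t: "t \<noteq> 0"
      "\<forall>i\<in>{1..m}. v i = t * (c i * eval_x (G' i) q' / eval_x (F' i) q')"
    using r[unfolded ratio_formula_def, rule_format, of F' G'] F' G' unfolding proj_eq_def by blast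
  have "v i = (t / u H) * (c i * eval_x (G i) q / eval_x (F i) q)" if i: "i \<in> {1..m}" for i
  proof -
    have "eval_x (G i) q = u (A i) * u H * eval_x (G' i) q'"
      using G' i by (simp add: AB[OF i] u(2))
    then show ?thesis
      using t(2) F' i u(1)[of "A i"] u(1)[of H] by simp
  qed
  then have "proj_eq m v (\<lambda>i. c i * eval_x (G i) q / eval_x (F i) q)"
    unfolding proj_eq_def using t(1) u(1)[of H] by (intro exI[of _ "t / u H"]) auto
  then show "\<exists>c. (\<forall>i\<in>{1..m}. c i \<in> Kfield m n \<and> c i \<noteq> 0) \<and>
        proj_eq m v (\<lambda>i. c i * eval_x (G i) q / eval_x (F i) q)"
    using c by blast
qed

lemma act_L_append: "act_L m n (w @ w') \<Lambda> = act_L m n w (act_L m n w' \<Lambda>)"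
  by (induction w) auto

lemma refl_L_add: "refl_L m n k (\<lambda>j. A j + B j) = (\<lambda>j. refl_L m n k A j + refl_L m n k B j)"
proof -
  have "bil m n h (\<lambda>j. A j + B j) = bil m n h A + bil m n h B" for h
    by (simp add: bil_def algebra_simps sum.distrib)
  then show ?thesis
    by (simp add: refl_L_def fun_eq_iff algebra_simps)
qed

lemma act_L_add: "act_L m n w (\<lambda>j. A j + B j) = (\<lambda>j. act_L m n w A j + act_L m n w B j)"
  by (induction w) (simp_all add: refl_L_add)

lemma refl_L_0_e:
  assumes "i \<in> {1..m}" "m \<le> n"
  shows "refl_L m n 0 (e i) = (\<lambda>j. e i j + hroot m 0 j)"
proof -
  have "bil m n (hroot m 0) (e i) = - 1"
    using assms(1) by (simp add: bil_hroot_0[OF assms(2)] e_def sum.delta)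
  then show ?thesis
    by (simp add: refl_L_def fun_eq_iff)
qed

text \<open>The reflection \<open>s_0\<close> shifts all of \<open>e_1\<close>, ...,
  \<open>e_m\<close> by the one root \<open>h_0\<close>, and w acts additively. The resulting shift
  by \<open>w.h_0\<close> is the common H of the ratio formula.\<close>

lemma act_L_snoc_0:
  assumes "i \<in> {1..m}" "m \<le> n"
  shows "act_L m n (w @ [0]) (e i) = (\<lambda>j. act_L m n w (e i) j + act_L m n w (hroot m 0) j)"
  by (simp add: act_L_append refl_L_0_e[OF assms] act_L_add)

text \<open>Here \<open>s_0.e_i\<close> is \<open>e_0\<close> minus all \<open>e_l\<close> with l up
  to m and l different from i, so its space consists of the linear forms vanishing at every
  coordinate point but the i-th.\<close>

lemma Xv_mem_Lpts:
  assumes "i \<in> {1..m}" "m \<le> n"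
  shows "Xv i \<in> Lpts m n (std_pt m C) (refl_L m n 0 (e i))"
proof -
  have "ord_ge (Xv i) (std_pt m C j) (- refl_L m n 0 (e i) j)" if j: "j \<in> {1..n}" for j
  proof (cases "j \<le> m")
    case True
    have "std_pt m C j l = (if l = j then 1 else 0)" for l
      using True by (simp add: std_pt_def)
    from ord_ge_coordinate_point[OF homog_Xv this] show ?thesis
      using j True unfolding refl_L_0_e[OF assms]
      by (auto simp: e_def hroot_def Xv_def lookup_single)
  next
    case False
    then show ?thesis
      unfolding refl_L_0_e[OF assms] by (intro ord_ge_nonpos) (simp add: e_def hroot_def)
  qed
  moreover have "refl_L m n 0 (e i) 0 = 1"
    using assms(1) unfolding refl_L_0_e[OF assms] by (simp add: e_def hroot_def)
  ultimately show ?thesis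
    using assms(1) homog_Xv[of i] Kpoly_Xv[of i m n] by (simp add: Lpts_def)
qed

lemma ratio_formula_orbit:
  assumes "1 < m" "m < n" "w \<in> lists {0..<n}" "good_cfg m n C"
  shows "ratio_formula m n (std_pt m C) (std_pt m C (n + 1)) (std_pt m (cfg_act m w C) (n + 1))
    (\<lambda>i. act_L m n w (e i)) (\<lambda>i. act_L m n (w @ [0]) (e i))"
  using assms(3,4)
proof (induction w arbitrary: C rule: list.induct)
  case Nil
  show ?case
    unfolding ratio_formula_def
  proof (intro allI impI)
    fix F G
    let ?P = "std_pt m C"
    let ?q = "?P (n + 1)"
    assume FG: "\<forall>i\<in>{1..m}. F i \<in> Lpts m n ?P (act_L m n [] (e i)) \<and> F i \<noteq> 0 \<and>
      G i \<in> Lpts m n ?P (act_L m n ([] @ [0]) (e i)) \<and> G i \<noteq> 0"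
    have "\<exists>c\<in>Kfield m n. c \<noteq> 0 \<and> ?q i = c * eval_x (G i) ?q / eval_x (F i) ?q" if i: "i \<in> {1..m}" for i
    proof -
      have F: "F i \<in> Cst ` Kfield m n" "F i \<noteq> 0"
        and G: "G i \<in> Lpts m n ?P (refl_L m n 0 (e i))" "G i \<noteq> 0"
        using FG i Lpts_e[of i m n ?P] by auto
      obtain b where b: "b \<in> Kfield m n" "F i = Cst b" "b \<noteq> 0"
        using F by (auto simp: Cst_eq_0_iff)
      have "one_dim m n (Lpts m n ?P (refl_L m n 0 (e i)))"
        using one_dim_orbit[OF assms(1,2) _ \<open>good_cfg m n C\<close>, of "[0]" i] i assms(2) by simp
      \<comment> \<open>The abstract generator f is compared with both \<open>G i\<close> and
        \<open>x_i\<close>, which makes \<open>G i\<close> a multiple of \<open>x_i\<close>.\<close>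
      then obtain f where "\<And>g. g \<in> Lpts m n ?P (refl_L m n 0 (e i)) \<Longrightarrow> \<exists>c\<in>Kfield m n. g = Cst c * f"
        unfolding one_dim_def by blast
      then obtain a a' where a: "a \<in> Kfield m n" "G i = Cst a * f" and a': "a' \<in> Kfield m n" "Xv i = Cst a' * f"
        using G(1) Xv_mem_Lpts[OF i, of n C] assms(2) by (meson less_imp_le)
      have ev: "eval_x (G i) ?q = a * eval_x f ?q" "?q i = a' * eval_x f ?q" "eval_x (F i) ?q = b"
        using arg_cong[OF a'(2), of "\<lambda>f. eval_x f ?q"] a(2) b(2)
        by (simp_all add: eval_x_eq_peval peval_mult peval_Cst peval_Xv is_hom_id)
      have "a \<noteq> 0"
        using a G(2) by (auto simp: is_homD[OF is_hom_Cst])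
      moreover have "a' \<noteq> 0"
      proof
        assume "a' = 0"
        then have "Xv i = 0"
          using a' by (simp add: is_homD[OF is_hom_Cst])
        then show False
          by (metis Xv_def lookup_single_eq lookup_zero zero_neq_one)
      qed
      ultimately show ?thesis
        \<comment> \<open>\<open>G i\<close> is \<open>a / a'\<close> times \<open>x_i\<close> and
          \<open>F i\<close> is the constant b, so this constant turns the quotient into the i-th
          coordinate of q.\<close>
        using a a' b ev by (intro bexI[of _ "b * a' / a"]) (auto intro!: Kfield_mult Kfield_divide)
    qed
    then have "\<forall>i\<in>{1..m}. \<exists>c. c \<in> Kfield m n \<and> c \<noteq> 0 \<and> ?q i = c * eval_x (G i) ?q / eval_x (F i) ?q"
      by blast
    then obtain c where "\<forall>i\<in>{1..m}. c i \<in> Kfield m n \<and> c i \<noteq> 0 \<and> ?q i = c i * eval_x (G i) ?q / eval_x (F i) ?q"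
      by (rule bchoice[THEN exE])
    then show "\<exists>c. (\<forall>i\<in>{1..m}. c i \<in> Kfield m n \<and> c i \<noteq> 0) \<and>
        proj_eq m (std_pt m (cfg_act m [] C) (n + 1)) (\<lambda>i. c i * eval_x (G i) ?q / eval_x (F i) ?q)"
      unfolding proj_eq_def by (intro exI[of _ c] conjI exI[of _ "1 :: fld"]) auto
  qed
next
  case (Cons k w)
  then have k: "k < n" "w \<in> lists {0..<n}" "w @ [0] \<in> lists {0..<n}"
    using assms(2) by auto
  have good: "good_cfg m n (cfg_step m k C)"
    using good_cfg_step Cons.prems(2) k(1) assms(1) by blast
  have "ratio_formula m n (std_pt m C) (std_pt m C (n + 1)) (std_pt m (cfg_act m w (cfg_step m k C)) (n + 1))
    (\<lambda>i. refl_L m n k (act_L m n w (e i))) (\<lambda>i. refl_L m n k (act_L m n (w @ [0]) (e i)))"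
  proof (rule ratio_formula_Lstep[where A = "\<lambda>i. act_L m n w (e i)"
        and B = "\<lambda>i. act_L m n (w @ [0]) (e i)" and H = "act_L m n w (hroot m 0)"])
    show "Lstep m n (std_pt m C) (std_pt m C (n + 1)) (std_pt m (cfg_step m k C))
        (std_pt m (cfg_step m k C) (n + 1)) (refl_L m n k)"
      by (rule good_cfg_Lstep[OF Cons.prems(2) k(1) assms(1,2)])
    show "act_L m n (w @ [0]) (e i) = (\<lambda>j. act_L m n w (e i) j + act_L m n w (hroot m 0) j)" if "i \<in> {1..m}" for i
      by (rule act_L_snoc_0[OF that]) (use assms(2) in simp)
  qed (use one_dim_orbit[OF assms(1,2) _ good] k Cons.IH[OF k(2) good] in auto)
  then show ?case
    by simp
qed

text \<open>Scaling coordinates by a turns \<open>pt m a\<close> into the normalized generic points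
  and leaves \<Lambda> alone. Both claims thereby reduce to normalized coordinates.\<close>

lemma Lstep_pt:
  assumes "m < n" and a: "\<forall>i\<in>{1..m}. a i \<in> Kfield m n \<and> a i \<noteq> 0"
  shows "Lstep m n (pt m a) (\<lambda>l. (if l = m then 1 else Z l) / a l)
    (std_pt m (gen_cfg n)) (std_pt m (gen_cfg n) (n + 1)) (\<lambda>\<Lambda>. \<Lambda>)"
proof (rule Lstep_diagonal[where c = a and \<sigma> = "\<lambda>j. j"])
  show "a i \<in> Kfield m n \<and> a i \<noteq> 0" if "i \<in> {1..m}" for i
    using a that by blast
  show "\<exists>l. l \<noteq> 0 \<and> (\<forall>i\<in>{1..m}. a i * pt m a j i = l * std_pt m (gen_cfg n) j i)" if "j \<in> {1..n}" for j
    \<comment> \<open>Scaling multiplies the j-th coordinate vector by \<open>a j\<close>; the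
      remaining points are defined with the inverse factors and need no scalar.\<close>
    using a that by (intro exI[of _ "if j \<le> m then a j else 1"]) (auto simp: pt_def std_pt_def gen_cfg_def)
  show "\<exists>l. l \<noteq> 0 \<and> (\<forall>i\<in>{1..m}. a i * ((if i = m then 1 else Z i) / a i) = l * std_pt m (gen_cfg n) (n + 1) i)"
    using a assms(1) by (intro exI[of _ 1]) (auto simp: std_pt_def gen_cfg_def)
qed auto

theorem theorem1:
  fixes m n :: nat and a :: "nat \<Rightarrow> fld"
  assumes "1 < m" and "m < n"
    and "\<forall>i\<in>{1..m}. a i \<in> Kfield m n \<and> a i \<noteq> 0"
  shows "(\<forall>\<Lambda>\<in>Mset m n. has_Kdim m n (Lsp m n a \<Lambda>) 1)
       \<and> (\<forall>w F G. w \<in> lists {0..<n}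
            \<longrightarrow> (\<forall>i\<in>{1..m}. F i \<in> Lsp m n a (act_L m n w (e i)) \<and> F i \<noteq> 0
                           \<and> G i \<in> Lsp m n a (act_L m n (w @ [0]) (e i)) \<and> G i \<noteq> 0)
            \<longrightarrow> (\<exists>c. (\<forall>i\<in>{1..m}. c i \<in> Kfield m n \<and> c i \<noteq> 0)
                   \<and> proj_eq m (\<lambda>i. if i = m then 1 else wz m n w i)
                       (\<lambda>i. c i * eval_x (G i) (\<lambda>l. (if l = m then 1 else Z l) / a l)
                                / eval_x (F i) (\<lambda>l. (if l = m then 1 else Z l) / a l))))"
proof (intro conjI ballI allI impI)
  note step = Lstep_pt[OF assms(2,3)]
  have good: "good_cfg m n (gen_cfg n)"
    by (rule good_gen_cfg[OF assms(1,2)])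
  fix \<Lambda> assume "\<Lambda> \<in> Mset m n"
  then obtain w i where \<Lambda>: "\<Lambda> = act_L m n w (e i)" "w \<in> lists {0..<n}" "1 \<le> i"
    unfolding Mset_def by blast
  have "one_dim m n (Lpts m n (std_pt m (gen_cfg n)) \<Lambda>)"
    unfolding \<Lambda>(1) by (rule one_dim_orbit[OF assms(1,2) \<Lambda>(2) good \<Lambda>(3)])
  then have "one_dim m n (Lsp m n a \<Lambda>)"
    using step unfolding Lstep_def Lsp_eq_Lpts by blast
  then show "has_Kdim m n (Lsp m n a \<Lambda>) 1"
    by (rule one_dim_imp_has_Kdim)
next
  note step = Lstep_pt[OF assms(2,3)]
  have good: "good_cfg m n (gen_cfg n)"
    by (rule good_gen_cfg[OF assms(1,2)])
  fix w F G
  assume w: "w \<in> lists {0..<n}"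
    and FG: "\<forall>i\<in>{1..m}. F i \<in> Lsp m n a (act_L m n w (e i)) \<and> F i \<noteq> 0
                           \<and> G i \<in> Lsp m n a (act_L m n (w @ [0]) (e i)) \<and> G i \<noteq> 0"
  let ?q = "\<lambda>l. (if l = m then 1 else Z l) / a l"
  have w0: "w @ [0] \<in> lists {0..<n}"
    using w assms(2) by simp
  have "ratio_formula m n (pt m a) ?q (std_pt m (cfg_act m w (gen_cfg n)) (n + 1))
      (\<lambda>i. act_L m n w (e i)) (\<lambda>i. act_L m n (w @ [0]) (e i))"
  proof (rule ratio_formula_Lstep[OF step])
    show "act_L m n (w @ [0]) (e i) = (\<lambda>j. act_L m n w (e i) j + act_L m n w (hroot m 0) j)" if "i \<in> {1..m}" for i
      by (rule act_L_snoc_0[OF that]) (use assms(2) in simp)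
  qed (use one_dim_orbit[OF assms(1,2) _ good] w w0 ratio_formula_orbit[OF assms(1,2) w good] in auto)
  moreover have "std_pt m (cfg_act m w (gen_cfg n)) (n + 1) = (\<lambda>i. if i = m then 1 else wz m n w i)"
    using assms(2) by (auto simp: std_pt_def wz_def fun_eq_iff)
  ultimately show "\<exists>c. (\<forall>i\<in>{1..m}. c i \<in> Kfield m n \<and> c i \<noteq> 0)
                   \<and> proj_eq m (\<lambda>i. if i = m then 1 else wz m n w i)
                       (\<lambda>i. c i * eval_x (G i) ?q / eval_x (F i) ?q)"
    using FG unfolding ratio_formula_def Lsp_eq_Lpts by simp
qed

end
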